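(* Let $n\ge1$, $\varepsilon\ne0$, let $\Omega\subseteq\mathbb{R}^{2n}$ be a bounded domain, $H\in C^1(\overline\Omega)$ and $\sigma\in[0,1]$, and let $u\in C^3(\Omega)\cap C^1(\overline\Omega)$ solve $$\operatorname{div}\left(\frac{Du+\sigma X}{\sqrt{\varepsilon^2+|Du+\sigma X|^2}}\right)=\sigma H\quad\text{in }\Omega.$$ Then there exists $C>0$ depending only on $n,\varepsilon,\|u\|_{L^\infty(\Omega)},\|H\|_{C^1(\overline\Omega)},\|X\|_{L^\infty(\Omega)}$ (thus independent of $\sigma\in[0,1]$) such that $$\|Du\|_{L^\infty(\Omega)}\le C\left(\|Du\|_{L^\infty(\partial\Omega)}+1\right).$$
   Context: Points of $\mathbb{R}^{2n}$ are $z=(x,y)$, $x,y\in\mathbb{R}^n$; $X(x,y)=(-y,x)$. $D$, $|\cdot|$, $\operatorname{div}$ are Euclidean. *)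

theory Defs
  imports "HOL-Analysis.Analysis"
begin

text \<open>Points of R^(2n) are pairs z = (x,y) with x, y in R^n (R^n = real^'n).\<close>

definition Xfield :: "((real^'n) \<times> (real^'n)) \<Rightarrow> ((real^'n) \<times> (real^'n))" where
  "Xfield z = (- snd z, fst z)"

definition grad :: "('a::euclidean_space \<Rightarrow> real) \<Rightarrow> 'a \<Rightarrow> 'a" where
  "grad u z = (\<Sum>b\<in>Basis. frechet_derivative u (at z) b *\<^sub>R b)"

definition divergence :: "('a::euclidean_space \<Rightarrow> 'a) \<Rightarrow> 'a \<Rightarrow> real" where
  "divergence F z = (\<Sum>b\<in>Basis. frechet_derivative F (at z) b \<bullet> b)"

fun Ck_on :: "nat \<Rightarrow> ('a::euclidean_space \<Rightarrow> 'b::real_normed_vector) \<Rightarrow> 'a set \<Rightarrow> bool" where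
  "Ck_on 0 f S = continuous_on S f"
| "Ck_on (Suc k) f S = (continuous_on S f \<and> f differentiable_on S \<and>
      (\<forall>b\<in>Basis. Ck_on k (\<lambda>z. frechet_derivative f (at z) b) S))"

definition C1_closure_ext :: "('a::euclidean_space \<Rightarrow> real) \<Rightarrow> ('a \<Rightarrow> 'a) \<Rightarrow> 'a set \<Rightarrow> bool" where
  "C1_closure_ext u G \<Omega> = (Ck_on 1 u \<Omega> \<and> continuous_on (closure \<Omega>) u \<and>
      continuous_on (closure \<Omega>) G \<and> (\<forall>z\<in>\<Omega>. G z = grad u z))"

end

theory Submission
  imports Defs
begin

text \<open>
  Bernstein's method, applied to the auxiliary function \<open>|Du|\<^sup>2 exp (2 \<beta> u)\<close>. Suppose it has an interior
  maximum. Write \<open>g = Du\<close>, \<open>A = D\<^sup>2u\<close>, \<open>p = g + \<sigma> X\<close> and \<open>W\<^sup>2 = \<epsilon>\<^sup>2 + |p|\<^sup>2\<close>. Since \<open>DX\<close> is skew, the equation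
  reads \<open>W\<^sup>2 tr A - p \<cdot> A p = \<sigma> H W\<^sup>3\<close>. The first order condition says that \<open>g\<close> is an eigenvector of \<open>A\<close> with
  eigenvalue \<open>- \<beta> |g|\<^sup>2\<close>, so that \<open>A = R - \<beta> g g\<^sup>T\<close> with \<open>R g = 0\<close>. Contracting the second order condition with
  \<open>W\<^sup>2 I - p p\<^sup>T\<close> and replacing the third derivatives by means of the equation differentiated in
  direction \<open>g\<close>, the contributions of order \<open>\<beta> |g|\<^sup>5\<close> cancel. The term \<open>\<beta>\<^sup>2 \<epsilon>\<^sup>2 |g|\<^sup>4\<close> survives and, for \<open>\<beta>\<close> large in terms
  of the data, dominates everything else once \<open>|g|\<close> is large: a contradiction. Hence \<open>|g|\<close> is bounded
  at an interior maximum, and otherwise the maximum lies on the boundary.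
\<close>

section \<open>Mean value theorem and symmetry of second derivatives\<close>

lemma has_real_derivative_along_line:
  fixes f :: "'a::real_normed_vector \<Rightarrow> real"
  assumes "(f has_derivative D) (at (x + r *\<^sub>R h))"
  shows "((\<lambda>r. f (x + r *\<^sub>R h)) has_real_derivative D h) (at r)"
proof -
  have "((\<lambda>r. x + r *\<^sub>R h) has_derivative (\<lambda>s. s *\<^sub>R h)) (at r)"
    by (auto intro!: derivative_eq_intros)
  from has_derivative_compose[OF this assms] show ?thesis
    using linear_scale[OF has_derivative_linear[OF assms]]
    by (simp add: has_field_derivative_def mult.commute[of _ "D h"])
qed

text \<open>The mean value theorem, used once in direction \<open>h\<close> and once in direction
  \<open>k\<close>, turns the second difference over a parallelogram into a single mixed derivative
  at an intermediate point. The left side is symmetric in \<open>h\<close> and \<open>k\<close>, so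
  the two orders of differentiation can be compared.\<close>

lemma second_difference_mvt:
  fixes f :: "'a::real_normed_vector \<Rightarrow> real"
  assumes t: "0 < t"
    and sub: "\<And>r q. 0 \<le> r \<Longrightarrow> r \<le> t \<Longrightarrow> 0 \<le> q \<Longrightarrow> q \<le> t \<Longrightarrow> z + r *\<^sub>R h + q *\<^sub>R k \<in> S"
    and D: "\<And>x. x \<in> S \<Longrightarrow> (f has_derivative D x) (at x)"
    and E: "\<And>x. x \<in> S \<Longrightarrow> ((\<lambda>x. D x h) has_derivative E x) (at x)"
  obtains r q where "0 < r" "r < t" "0 < q" "q < t"
    "f (z + t *\<^sub>R h + t *\<^sub>R k) - f (z + t *\<^sub>R h) - f (z + t *\<^sub>R k) + f z
      = t\<^sup>2 * E (z + r *\<^sub>R h + q *\<^sub>R k) k"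
proof -
  \<comment> \<open>The \<open>k\<close>-increment as a function of the step along \<open>h\<close>;
    writing \<open>0 *\<^sub>R k\<close> gives both terms the shape covered by
    \<open>d1\<close>.\<close>
  define \<phi> where "\<phi> r = f (z + r *\<^sub>R h + t *\<^sub>R k) - f (z + r *\<^sub>R h + 0 *\<^sub>R k)" for r
  have d1: "((\<lambda>r. f (z + r *\<^sub>R h + q *\<^sub>R k)) has_real_derivative D (z + r *\<^sub>R h + q *\<^sub>R k) h) (at r)"
    if "0 \<le> r" "r \<le> t" "0 \<le> q" "q \<le> t" for r q
    using has_real_derivative_along_line[of f _ "z + q *\<^sub>R k" r h] D[OF sub[OF that]]
    by (simp add: add_ac)
  have d2: "((\<lambda>q. D (z + r *\<^sub>R h + q *\<^sub>R k) h) has_real_derivative E (z + r *\<^sub>R h + q *\<^sub>R k) k) (at q)"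
    if "0 \<le> r" "r \<le> t" "0 \<le> q" "q \<le> t" for r q
    by (rule has_real_derivative_along_line[OF E[OF sub[OF that]]])
  have "\<exists>r. 0 < r \<and> r < t \<and>
      \<phi> t - \<phi> 0 = (t - 0) * (D (z + r *\<^sub>R h + t *\<^sub>R k) h - D (z + r *\<^sub>R h + 0 *\<^sub>R k) h)"
    unfolding \<phi>_def using t by (intro MVT2 DERIV_diff d1) auto
  then obtain r where r: "0 < r" "r < t"
    "\<phi> t - \<phi> 0 = t * (D (z + r *\<^sub>R h + t *\<^sub>R k) h - D (z + r *\<^sub>R h + 0 *\<^sub>R k) h)" by auto
  have "\<exists>q. 0 < q \<and> q < t \<and> D (z + r *\<^sub>R h + t *\<^sub>R k) h - D (z + r *\<^sub>R h + 0 *\<^sub>R k) h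
      = (t - 0) * E (z + r *\<^sub>R h + q *\<^sub>R k) k"
    using t r by (intro MVT2 d2) auto
  then obtain q where q: "0 < q" "q < t" "D (z + r *\<^sub>R h + t *\<^sub>R k) h - D (z + r *\<^sub>R h + 0 *\<^sub>R k) h
      = t * E (z + r *\<^sub>R h + q *\<^sub>R k) k" by auto
  have "\<phi> t - \<phi> 0 = t\<^sup>2 * E (z + r *\<^sub>R h + q *\<^sub>R k) k"
    unfolding r(3) q(3) by (simp add: power2_eq_square)
  then have "f (z + t *\<^sub>R h + t *\<^sub>R k) - f (z + t *\<^sub>R h) - f (z + t *\<^sub>R k) + f z
      = t\<^sup>2 * E (z + r *\<^sub>R h + q *\<^sub>R k) k"
    by (simp add: \<phi>_def)
  with r(1,2) q(1,2) show thesis by (rule that)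
qed

text \<open>Both mixed derivatives, taken at suitable points near \<open>z\<close>, equal the same
  second difference quotient; continuity carries the equality to \<open>z\<close>.\<close>

lemma second_derivative_symmetric:
  fixes f :: "'a::real_normed_vector \<Rightarrow> real"
  assumes S: "open S" "z \<in> S"
    and D: "\<And>x. x \<in> S \<Longrightarrow> (f has_derivative D x) (at x)"
    and E: "\<And>x. x \<in> S \<Longrightarrow> ((\<lambda>x. D x h) has_derivative E x) (at x)"
    and F: "\<And>x. x \<in> S \<Longrightarrow> ((\<lambda>x. D x k) has_derivative F x) (at x)"
    and cE: "continuous_on S (\<lambda>x. E x k)" and cF: "continuous_on S (\<lambda>x. F x h)"
  shows "E z k = F z h"
proof (rule ccontr)
  assume ne: "E z k \<noteq> F z h"
  \<comment> \<open>Half the gap: two equal numbers within \<open>e\<close> of \<open>E z k\<close>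
    and \<open>F z h\<close> respectively would make the gap smaller than
    \<open>2 * e\<close>.\<close>
  define e where "e = \<bar>E z k - F z h\<bar> / 2"
  have "e > 0" using ne by (simp add: e_def)
  obtain d1 where d1: "d1 > 0" "\<And>x. dist x z < d1 \<Longrightarrow> dist (E x k) (E z k) < e"
    using S cE \<open>e > 0\<close> unfolding continuous_on_eq_continuous_at[OF S(1)] continuous_at_eps_delta
    by blast
  obtain d2 where d2: "d2 > 0" "\<And>x. dist x z < d2 \<Longrightarrow> dist (F x h) (F z h) < e"
    using S cF \<open>e > 0\<close> unfolding continuous_on_eq_continuous_at[OF S(1)] continuous_at_eps_delta
    by blast
  obtain d3 where d3: "d3 > 0" "ball z d3 \<subseteq> S"
    using S open_contains_ball by blast
  \<comment> \<open>The parallelogram with sides \<open>t *\<^sub>R h\<close> and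
    \<open>t *\<^sub>R k\<close> stays within \<open>t * c\<close> of \<open>z\<close>, which is
    half the smallest of the three radii. The summand 1 keeps \<open>c\<close> positive when
    \<open>h\<close> and \<open>k\<close> vanish.\<close>
  define c where "c = norm h + norm k + 1"
  define t where "t = min d1 (min d2 d3) / (2 * c)"
  have c: "c > 0" by (simp add: c_def add_nonneg_pos)
  have t: "t > 0" using d1 d2 d3 c by (simp add: t_def)
  have near: "dist (z + r *\<^sub>R h + q *\<^sub>R k) z < min d1 (min d2 d3)"
    if "0 \<le> r" "r \<le> t" "0 \<le> q" "q \<le> t" for r q
  proof -
    have "dist (z + r *\<^sub>R h + q *\<^sub>R k) z = norm (r *\<^sub>R h + q *\<^sub>R k)"
      by (simp add: dist_norm add.assoc)
    also have "\<dots> \<le> r * norm h + q * norm k"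
      using norm_triangle_ineq[of "r *\<^sub>R h" "q *\<^sub>R k"] that by simp
    also have "\<dots> \<le> t * norm h + t * norm k"
      using that by (intro add_mono mult_right_mono) auto
    also have "\<dots> \<le> t * c" using t by (simp add: c_def algebra_simps)
    also have "\<dots> = min d1 (min d2 d3) / 2" using c by (simp add: t_def)
    also have "\<dots> < min d1 (min d2 d3)" using d1 d2 d3 by auto
    finally show ?thesis .
  qed
  have inS: "z + r *\<^sub>R h + q *\<^sub>R k \<in> S" if "0 \<le> r" "r \<le> t" "0 \<le> q" "q \<le> t" for r q
    using near[OF that] d3 by (auto simp: dist_commute subset_iff)
  obtain r q where rq: "0 < r" "r < t" "0 < q" "q < t"
    "f (z + t *\<^sub>R h + t *\<^sub>R k) - f (z + t *\<^sub>R h) - f (z + t *\<^sub>R k) + f z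
      = t\<^sup>2 * E (z + r *\<^sub>R h + q *\<^sub>R k) k"
    by (rule second_difference_mvt[OF t inS D E]) auto
  have inS': "z + r *\<^sub>R k + q *\<^sub>R h \<in> S" if "0 \<le> r" "r \<le> t" "0 \<le> q" "q \<le> t" for r q
    using inS[of q r] that by (simp add: add_ac)
  obtain r' q' where rq': "0 < r'" "r' < t" "0 < q'" "q' < t"
    "f (z + t *\<^sub>R k + t *\<^sub>R h) - f (z + t *\<^sub>R k) - f (z + t *\<^sub>R h) + f z
      = t\<^sup>2 * F (z + r' *\<^sub>R k + q' *\<^sub>R h) h"
    by (rule second_difference_mvt[OF t inS' D F]) auto
  have "t\<^sup>2 * E (z + r *\<^sub>R h + q *\<^sub>R k) k = t\<^sup>2 * F (z + q' *\<^sub>R h + r' *\<^sub>R k) h"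
  proof -
    have "z + t *\<^sub>R k + t *\<^sub>R h = z + t *\<^sub>R h + t *\<^sub>R k"
      and "z + r' *\<^sub>R k + q' *\<^sub>R h = z + q' *\<^sub>R h + r' *\<^sub>R k" by simp_all
    with rq(5) rq'(5) show ?thesis by (simp only:)
  qed
  then have "E (z + r *\<^sub>R h + q *\<^sub>R k) k = F (z + q' *\<^sub>R h + r' *\<^sub>R k) h"
    using t by simp
  moreover have "dist (E (z + r *\<^sub>R h + q *\<^sub>R k) k) (E z k) < e"
    using near[of r q] rq by (intro d1) auto
  moreover have "dist (F (z + q' *\<^sub>R h + r' *\<^sub>R k) h) (F z h) < e"
    using near[of q' r'] rq' by (intro d2) auto
  ultimately show False by (auto simp: e_def dist_real_def abs_if split: if_splits)
qed

section \<open>Hessian and third derivative of a C^3 function\<close>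

lemma Ck_on_has_derivative:
  assumes "Ck_on (Suc k) f S" "open S" "x \<in> S"
  shows "(f has_derivative frechet_derivative f (at x)) (at x)"
  using assms by (auto simp: differentiable_on_eq_differentiable_at frechet_derivative_works[symmetric])

lemma Ck_on_2_symmetric:
  fixes f :: "'a::euclidean_space \<Rightarrow> real"
  assumes C: "Ck_on 2 f S" and S: "open S" "z \<in> S" and b: "b \<in> Basis" and c: "c \<in> Basis"
  shows "frechet_derivative (\<lambda>x. frechet_derivative f (at x) b) (at z) c
    = frechet_derivative (\<lambda>x. frechet_derivative f (at x) c) (at z) b"
proof -
  have C1: "Ck_on (Suc 0) (\<lambda>x. frechet_derivative f (at x) b) S"
    if "b \<in> Basis" for b using C that by (simp add: numeral_2_eq_2)
  show ?thesis
  proof (rule second_derivative_symmetric[OF S])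
    show "(f has_derivative frechet_derivative f (at x)) (at x)" if "x \<in> S" for x
      using C S that by (intro Ck_on_has_derivative[of 1]) (auto simp: numeral_2_eq_2)
  qed (use C1 b c S in \<open>auto intro!: Ck_on_has_derivative[of 0]\<close>)
qed

lemma linear_Basis_sum:
  fixes D :: "'a::euclidean_space \<Rightarrow> 'b::real_vector"
  assumes "linear D"
  shows "D h = (\<Sum>b\<in>Basis. (h \<bullet> b) *\<^sub>R D b)"
proof -
  have "D h = D (\<Sum>b\<in>Basis. (h \<bullet> b) *\<^sub>R b)" by (simp add: euclidean_representation)
  also have "\<dots> = (\<Sum>b\<in>Basis. (h \<bullet> b) *\<^sub>R D b)"
    by (simp add: linear_sum[OF assms] linear_scale[OF assms])
  finally show ?thesis .
qed

lemma has_derivative_grad: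
  fixes u :: "'a::euclidean_space \<Rightarrow> real"
  assumes "u differentiable (at z)"
  shows "(u has_derivative (\<lambda>h. grad u z \<bullet> h)) (at z)"
proof -
  have D: "(u has_derivative frechet_derivative u (at z)) (at z)"
    using assms frechet_derivative_works by blast
  have "frechet_derivative u (at z) h = grad u z \<bullet> h" for h
    using linear_Basis_sum[OF has_derivative_linear[OF D], of h]
    by (simp add: grad_def inner_sum_left inner_commute[of h] mult.commute)
  then have "frechet_derivative u (at z) = (\<lambda>h. grad u z \<bullet> h)" by blast
  with D show ?thesis by simp
qed

text \<open>\<open>A z\<close> is the Hessian as a linear map and \<open>T z h\<close> its
  derivative in direction \<open>h\<close>. The last two properties are transpositions that generate
  all permutations of the slots of \<open>T z h k \<bullet> m\<close>; this total symmetry later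
  identifies traces of third derivatives with the differentiated equation.\<close>

lemma C3_derivatives:
  fixes u :: "'a::euclidean_space \<Rightarrow> real"
  assumes C: "Ck_on 3 u S" and S: "open S"
  obtains A T where
    "\<And>z. z \<in> S \<Longrightarrow> (grad u has_derivative A z) (at z)"
    "\<And>z h k. z \<in> S \<Longrightarrow> A z h \<bullet> k = h \<bullet> A z k"
    "\<And>z k. z \<in> S \<Longrightarrow> ((\<lambda>x. A x k) has_derivative (\<lambda>h. T z h k)) (at z)"
    "\<And>z h. z \<in> S \<Longrightarrow> linear (T z h)"
    "\<And>z h k. z \<in> S \<Longrightarrow> T z h k = T z k h"
    "\<And>z h k m. z \<in> S \<Longrightarrow> T z h k \<bullet> m = T z h m \<bullet> k"
proof -
  define v where "v b x = frechet_derivative u (at x) b" for b x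
  define a where "a b c x = frechet_derivative (v b) (at x) c" for b c x
  define t where "t b c d x = frechet_derivative (a b c) (at x) d" for b c d x
  define A where "A x h = (\<Sum>b\<in>Basis. (\<Sum>c\<in>Basis. (h \<bullet> c) * a b c x) *\<^sub>R b)" for x h
  define T where "T x h k = (\<Sum>b\<in>Basis. (\<Sum>c\<in>Basis. (k \<bullet> c) * (\<Sum>d\<in>Basis. (h \<bullet> d) * t b c d x)) *\<^sub>R b)" for x h k
  have Cv: "Ck_on 2 (v b) S" if "b \<in> Basis" for b
    using C that by (simp add: v_def[abs_def] numeral_3_eq_3 numeral_2_eq_2)
  have Ca: "Ck_on 1 (a b c) S" if "b \<in> Basis" "c \<in> Basis" for b c
    using Cv[of b] that by (simp add: a_def[abs_def] numeral_2_eq_2)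
  have dv: "(v b has_derivative (\<lambda>h. \<Sum>c\<in>Basis. (h \<bullet> c) * a b c x)) (at x)" if "b \<in> Basis" "x \<in> S" for b x
  proof -
    have "(v b has_derivative frechet_derivative (v b) (at x)) (at x)"
      using Cv[OF that(1)] S that by (intro Ck_on_has_derivative[of 1]) (auto simp: numeral_2_eq_2)
    then show ?thesis
      by (rule has_derivative_eq_rhs)
        (simp add: a_def fun_eq_iff linear_Basis_sum[OF has_derivative_linear[OF \<open>(v b has_derivative _) _\<close>], symmetric]
          flip: real_scaleR_def)
  qed
  have da: "(a b c has_derivative (\<lambda>h. \<Sum>d\<in>Basis. (h \<bullet> d) * t b c d x)) (at x)"
    if "b \<in> Basis" "c \<in> Basis" "x \<in> S" for b c x
  proof -
    have "(a b c has_derivative frechet_derivative (a b c) (at x)) (at x)"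
      using Ca[OF that(1,2)] S that by (intro Ck_on_has_derivative[of 0]) auto
    then show ?thesis
      by (rule has_derivative_eq_rhs)
        (simp add: t_def fun_eq_iff linear_Basis_sum[OF has_derivative_linear[OF \<open>(a b c has_derivative _) _\<close>], symmetric]
          flip: real_scaleR_def)
  qed
  have C2u: "Ck_on 2 u S"
    using C by (simp add: numeral_3_eq_3 numeral_2_eq_2)
  \<comment> \<open>\<open>sa\<close> is the symmetry of the Hessian of \<open>u\<close>,
    \<open>st\<close> that of the Hessian of each partial derivative \<open>v b\<close>, and
    \<open>st'\<close> arises by differentiating \<open>sa\<close> on the open set
    \<open>S\<close>.\<close>
  have sa: "a b c x = a c b x" if "b \<in> Basis" "c \<in> Basis" "x \<in> S" for b c x
    using Ck_on_2_symmetric[OF C2u S that(3,1,2)] by (simp add: a_def v_def[abs_def])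
  have st: "t b c d x = t b d c x" if "b \<in> Basis" "c \<in> Basis" "d \<in> Basis" "x \<in> S" for b c d x
    using Ck_on_2_symmetric[OF Cv S that(4,2,3)] that by (simp add: t_def a_def[abs_def])
  have st': "t b c d x = t c b d x" if "b \<in> Basis" "c \<in> Basis" "d \<in> Basis" "x \<in> S" for b c d x
    unfolding t_def
    by (rule frechet_derivative_transform_within_open[THEN fun_cong, of _ _ S])
       (use that S sa da[of b c x] in \<open>auto simp: differentiable_def\<close>)
  show thesis
  proof
    fix z assume z: "z \<in> S"
    have g: "grad u = (\<lambda>x. \<Sum>b\<in>Basis. v b x *\<^sub>R b)" by (simp add: grad_def v_def fun_eq_iff)
    show "(grad u has_derivative A z) (at z)"
      unfolding g A_def[abs_def] using z
      by (intro has_derivative_sum has_derivative_scaleR_left dv)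
    fix h k
    show "A z h \<bullet> k = h \<bullet> A z k"
    proof -
      have "A z h \<bullet> k = (\<Sum>b\<in>Basis. \<Sum>c\<in>Basis. (k \<bullet> b) * ((h \<bullet> c) * a b c z))"
        by (simp add: A_def inner_sum_left sum_distrib_left inner_commute[of k] mult.commute)
      also have "\<dots> = (\<Sum>c\<in>Basis. \<Sum>b\<in>Basis. (k \<bullet> b) * ((h \<bullet> c) * a b c z))"
        by (rule sum.swap)
      also have "\<dots> = h \<bullet> A z k"
        unfolding A_def inner_sum_right inner_scaleR_right sum_distrib_right
        using z by (intro sum.cong refl) (simp add: sa[of _ _ z])
      finally show ?thesis .
    qed
    show "((\<lambda>x. A x k) has_derivative (\<lambda>h. T z h k)) (at z)"
      unfolding A_def T_def using z
      by (intro has_derivative_sum has_derivative_scaleR_left has_derivative_mult_right da)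
    show "linear (T z h)"
      unfolding T_def
      by (rule linearI)
        (simp_all add: inner_left_distrib distrib_right sum.distrib scaleR_left.add
          scaleR_sum_right sum_distrib_left mult.assoc)
    show "T z h k = T z k h"
    proof -
      have "(\<Sum>c\<in>Basis. (k \<bullet> c) * (\<Sum>d\<in>Basis. (h \<bullet> d) * t b c d z))
         = (\<Sum>c\<in>Basis. (h \<bullet> c) * (\<Sum>d\<in>Basis. (k \<bullet> d) * t b c d z))" if "b \<in> Basis" for b
      proof -
        have "(\<Sum>c\<in>Basis. (k \<bullet> c) * (\<Sum>d\<in>Basis. (h \<bullet> d) * t b c d z))
          = (\<Sum>c\<in>Basis. \<Sum>d\<in>Basis. (k \<bullet> c) * ((h \<bullet> d) * t b c d z))"
          by (simp add: sum_distrib_left)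
        also have "\<dots> = (\<Sum>d\<in>Basis. \<Sum>c\<in>Basis. (k \<bullet> c) * ((h \<bullet> d) * t b c d z))"
          by (rule sum.swap)
        also have "\<dots> = (\<Sum>c\<in>Basis. (h \<bullet> c) * (\<Sum>d\<in>Basis. (k \<bullet> d) * t b c d z))"
          unfolding sum_distrib_left
          using z that by (intro sum.cong refl) (simp add: st[of b _ _ z])
        finally show ?thesis .
      qed
      then show ?thesis by (simp add: T_def)
    qed
    fix m
    show "T z h k \<bullet> m = T z h m \<bullet> k"
    proof -
      let ?s = "\<lambda>b c. \<Sum>d\<in>Basis. (h \<bullet> d) * t b c d z"
      have "T z h k \<bullet> m = (\<Sum>b\<in>Basis. \<Sum>c\<in>Basis. (m \<bullet> b) * ((k \<bullet> c) * ?s b c))"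
        unfolding T_def inner_sum_left inner_scaleR_left sum_distrib_right
        by (simp only: inner_commute[of m] mult.commute)
      also have "\<dots> = (\<Sum>c\<in>Basis. \<Sum>b\<in>Basis. (m \<bullet> b) * ((k \<bullet> c) * ?s b c))"
        by (rule sum.swap)
      also have "\<dots> = (\<Sum>c\<in>Basis. \<Sum>b\<in>Basis. (m \<bullet> b) * ((k \<bullet> c) * ?s c b))"
        using z by (intro sum.cong refl) (auto simp: st')
      also have "\<dots> = T z h m \<bullet> k"
        unfolding T_def inner_sum_left inner_scaleR_left sum_distrib_right
        by (simp only: inner_commute[of _ k] mult_ac)
      finally show ?thesis .
    qed
  qed
qed

section \<open>Second-order conditions at a maximum\<close>

text \<open>One-variable calculus on the line through \<open>z\<close> in direction
  \<open>h\<close>: at a critical point a positive second derivative would make \<open>f\<close>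
  increase strictly just beyond \<open>z\<close>.\<close>

lemma second_derivative_test_max:
  fixes f :: "'a::real_normed_vector \<Rightarrow> real"
  assumes S: "open S" "z \<in> S" and max: "\<And>x. x \<in> S \<Longrightarrow> f x \<le> f z"
    and D: "\<And>x. x \<in> S \<Longrightarrow> (f has_derivative D x) (at x)"
    and E: "((\<lambda>x. D x h) has_derivative E) (at z)"
  shows "D z h = 0" "E h \<le> 0"
proof -
  obtain r where r: "r > 0" "ball z r \<subseteq> S" using S open_contains_ball by blast
  \<comment> \<open>The added 1 avoids a zero denominator when \<open>h = 0\<close>.\<close>
  define d where "d = r / (norm h + 1)"
  have n: "norm h + 1 > 0" by (simp add: add_nonneg_pos)
  then have "d > 0" using r by (simp add: d_def)
  moreover have "z + s *\<^sub>R h \<in> S" if "\<bar>s\<bar> < d" for s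
  proof -
    have "norm (s *\<^sub>R h) \<le> \<bar>s\<bar> * (norm h + 1)" by (simp add: mult_left_mono)
    also have "\<dots> < r" using that n by (simp add: d_def pos_less_divide_eq)
    finally show ?thesis using r(2) by (auto simp: dist_norm subset_iff)
  qed
  ultimately have d: "d > 0" "\<And>s. \<bar>s\<bar> < d \<Longrightarrow> z + s *\<^sub>R h \<in> S" by auto
  have der: "((\<lambda>r. f (z + r *\<^sub>R h)) has_real_derivative D (z + r *\<^sub>R h) h) (at r)" if "\<bar>r\<bar> < d" for r
    using d(2)[OF that] D by (intro has_real_derivative_along_line) auto
  show Dz: "D z h = 0"
    using DERIV_local_max[OF der[of 0] d(1)] d max by simp
  have "((\<lambda>r. D (z + r *\<^sub>R h) h) has_real_derivative E h) (at 0)"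
    by (rule has_real_derivative_along_line) (use E in simp)
  note inc = DERIV_pos_inc_right[OF this]
  show "E h \<le> 0"
  proof (rule ccontr)
    assume "\<not> E h \<le> 0"
    then obtain d' where d': "d' > 0" "\<And>r. 0 < r \<Longrightarrow> r < d' \<Longrightarrow> 0 < D (z + r *\<^sub>R h) h"
      using inc Dz by auto
    define s where "s = min d d' / 2"
    have s: "0 < s" "s < d" "s < d'" using d(1) d'(1) by (auto simp: s_def)
    have "\<exists>r. 0 < r \<and> r < s \<and> f (z + s *\<^sub>R h) - f (z + 0 *\<^sub>R h) = (s - 0) * D (z + r *\<^sub>R h) h"
      using s by (intro MVT2 der) auto
    then obtain r where r: "0 < r" "r < s" "f (z + s *\<^sub>R h) - f z = s * D (z + r *\<^sub>R h) h" by auto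
    have "0 < s * D (z + r *\<^sub>R h) h" using r s d'(2)[of r] by simp
    moreover have "f (z + s *\<^sub>R h) \<le> f z" using d(2)[of s] s max by simp
    ultimately show False using r(3) by simp
  qed
qed

text \<open>By Lagrange's identity, |p|^2 I - p p^T is half the sum of the rank-one matrices built
  from the vectors \<open>?n b c\<close>, so its contraction with a negative semidefinite form is a
  sum of nonpositive values. Together with e I it is the coefficient matrix of the mean curvature
  operator.\<close>

lemma trace_form_nonpos:
  fixes p :: "'a::euclidean_space" and B :: "'a \<Rightarrow> 'a \<Rightarrow> real"
  assumes bil: "bilinear B" and neg: "\<And>h. B h h \<le> 0" and "0 \<le> e"
  shows "(e + p \<bullet> p) * (\<Sum>b\<in>Basis. B b b) - B p p \<le> 0"
proof -
  let ?n = "\<lambda>b c. (p \<bullet> b) *\<^sub>R c - (p \<bullet> c) *\<^sub>R b"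
  have pp: "p \<bullet> p = (\<Sum>b\<in>Basis. (p \<bullet> b)\<^sup>2)"
    by (simp add: euclidean_inner[of p p] power2_eq_square)
  have Bpp: "B p p = (\<Sum>b\<in>Basis. \<Sum>c\<in>Basis. (p \<bullet> b) * (p \<bullet> c) * B b c)"
  proof -
    have 1: "B p p = (\<Sum>b\<in>Basis. (p \<bullet> b) * B b p)"
      using linear_Basis_sum[of "\<lambda>x. B x p" p] bil by (simp add: bilinear_def)
    have 2: "B b p = (\<Sum>c\<in>Basis. (p \<bullet> c) * B b c)" for b
      using linear_Basis_sum[of "B b" p] bil by (simp add: bilinear_def)
    show ?thesis unfolding 1 by (subst 2) (simp add: sum_distrib_left mult.assoc)
  qed
  have "B (?n b c) (?n b c) = (p \<bullet> b)\<^sup>2 * B c c + (p \<bullet> c)\<^sup>2 * B b b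
      - (p \<bullet> c) * (p \<bullet> b) * B c b - (p \<bullet> b) * (p \<bullet> c) * B b c" for b c
    by (simp add: bilinear_lsub[OF bil] bilinear_rsub[OF bil] bilinear_lmul[OF bil]
        bilinear_rmul[OF bil] power2_eq_square algebra_simps)
  then have "(\<Sum>b\<in>Basis. \<Sum>c\<in>Basis. B (?n b c) (?n b c))
     = (\<Sum>b\<in>Basis. \<Sum>c\<in>Basis. (p \<bullet> b)\<^sup>2 * B c c) + (\<Sum>b\<in>Basis. \<Sum>c\<in>Basis. (p \<bullet> c)\<^sup>2 * B b b)
      - (\<Sum>b\<in>Basis. \<Sum>c\<in>Basis. (p \<bullet> c) * (p \<bullet> b) * B c b) - B p p"
    by (simp add: sum.distrib sum_subtractf Bpp)
  also have "(\<Sum>b\<in>Basis. \<Sum>c\<in>Basis. (p \<bullet> c) * (p \<bullet> b) * B c b) = B p p"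
    unfolding Bpp by (rule sum.swap)
  also have "(\<Sum>b\<in>Basis. \<Sum>c\<in>Basis. (p \<bullet> b)\<^sup>2 * B c c) = (p \<bullet> p) * (\<Sum>b\<in>Basis. B b b)"
    by (simp add: pp sum_product)
  also have "(\<Sum>b\<in>Basis. \<Sum>c\<in>Basis. (p \<bullet> c)\<^sup>2 * B b b) = (p \<bullet> p) * (\<Sum>b\<in>Basis. B b b)"
    by (subst sum.swap) (simp add: pp sum_product)
  finally have "2 * ((p \<bullet> p) * (\<Sum>b\<in>Basis. B b b) - B p p) = (\<Sum>b\<in>Basis. \<Sum>c\<in>Basis. B (?n b c) (?n b c))"
    by simp
  also have "\<dots> \<le> 0" by (intro sum_nonpos neg)
  finally have "(p \<bullet> p) * (\<Sum>b\<in>Basis. B b b) - B p p \<le> 0" by simp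
  moreover have "e * (\<Sum>b\<in>Basis. B b b) \<le> 0"
    using \<open>0 \<le> e\<close> by (intro mult_nonneg_nonpos sum_nonpos neg)
  ultimately show ?thesis by (simp add: algebra_simps)
qed

section \<open>The mean curvature operator and its linearization\<close>

lemma has_derivative_area_element:
  fixes p :: "'a::real_normed_vector \<Rightarrow> 'b::real_inner"
  assumes "(p has_derivative P) (at z)" "e \<noteq> 0"
  shows "((\<lambda>x. sqrt (e\<^sup>2 + p x \<bullet> p x)) has_derivative (\<lambda>h. (p z \<bullet> P h) / sqrt (e\<^sup>2 + p z \<bullet> p z))) (at z)"
proof -
  have pos: "e\<^sup>2 + p z \<bullet> p z > 0" using assms(2) by (simp add: add_pos_nonneg)
  show ?thesis
    by (rule has_derivative_eq_rhs, rule has_derivative_real_sqrt[where g="\<lambda>x. e\<^sup>2 + p x \<bullet> p x", OF pos])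
      (rule derivative_intros assms(1) | use pos in \<open>simp add: fun_eq_iff inner_commute divide_simps\<close>)+
qed

text \<open>Non-divergence form of the operator. \<open>P\<close> enters only through its trace and
  its quadratic form at \<open>p z\<close>, hence a skew part of \<open>P\<close> will drop
  out.\<close>

lemma divergence_normalized_field:
  fixes p :: "'a::euclidean_space \<Rightarrow> 'a"
  assumes p: "(p has_derivative P) (at z)" and e: "e \<noteq> 0"
  defines "W \<equiv> sqrt (e\<^sup>2 + p z \<bullet> p z)"
  shows "divergence (\<lambda>w. (1 / sqrt (e\<^sup>2 + (norm (p w))\<^sup>2)) *\<^sub>R p w) z * W ^ 3
    = W\<^sup>2 * (\<Sum>b\<in>Basis. P b \<bullet> b) - p z \<bullet> P (p z)"
proof -
  have W: "W > 0" using e by (simp add: W_def add_pos_nonneg)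
  have d: "((\<lambda>w. (1 / sqrt (e\<^sup>2 + (norm (p w))\<^sup>2)) *\<^sub>R p w) has_derivative
      (\<lambda>h. (1 / W) *\<^sub>R P h - ((p z \<bullet> P h) / W ^ 3) *\<^sub>R p z)) (at z)"
    unfolding power2_norm_eq_inner
    by (rule has_derivative_eq_rhs[OF has_derivative_scaleR[OF has_derivative_divide[OF has_derivative_const
        has_derivative_area_element[OF p e]] p]])
      (use W in \<open>auto simp: fun_eq_iff W_def power3_eq_cube divide_simps\<close>)
  have "linear P" using p has_derivative_linear by blast
  then have lin: "linear (\<lambda>h. p z \<bullet> P h)"
    by (auto intro!: linearI simp: linear_add linear_scale inner_add_right)
  have "divergence (\<lambda>w. (1 / sqrt (e\<^sup>2 + (norm (p w))\<^sup>2)) *\<^sub>R p w) z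
    = (\<Sum>b\<in>Basis. (1 / W) * (P b \<bullet> b) - ((p z \<bullet> b) * (p z \<bullet> P b)) / W ^ 3)"
    unfolding divergence_def frechet_derivative_at[OF d, symmetric]
    by (simp add: inner_diff_left mult.commute)
  also have "\<dots> = (\<Sum>b\<in>Basis. P b \<bullet> b) / W - (\<Sum>b\<in>Basis. (p z \<bullet> b) * (p z \<bullet> P b)) / W ^ 3"
    by (simp add: sum_subtractf sum_divide_distrib)
  also have "(\<Sum>b\<in>Basis. (p z \<bullet> b) * (p z \<bullet> P b)) = p z \<bullet> P (p z)"
    using linear_Basis_sum[OF lin, of "p z"] by simp
  finally show ?thesis using W by (simp add: field_simps power2_eq_square power3_eq_cube)
qed

text \<open>The equation differentiated in direction \<open>h\<close>; it expresses the third-order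
  terms of the second-order condition by derivatives of lower order.\<close>

lemma linearized_equation:
  fixes p :: "'a::euclidean_space \<Rightarrow> 'a" and A T :: "'a \<Rightarrow> 'a \<Rightarrow> 'a"
  assumes S: "open S" "z \<in> S" and e: "e \<noteq> 0"
    and p: "(p has_derivative P) (at z)"
    and A: "\<And>k. ((\<lambda>x. A x k) has_derivative (\<lambda>h. T h k)) (at z)"
    and linA: "\<And>x. x \<in> S \<Longrightarrow> linear (A x)" and linT: "linear (T h)"
    and H: "(H has_derivative H') (at z)"
    and eq: "\<And>x. x \<in> S \<Longrightarrow> (e\<^sup>2 + p x \<bullet> p x) * (\<Sum>b\<in>Basis. A x b \<bullet> b) - p x \<bullet> A x (p x)
      = H x * sqrt (e\<^sup>2 + p x \<bullet> p x) ^ 3"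
  defines "W \<equiv> sqrt (e\<^sup>2 + p z \<bullet> p z)"
  shows "W\<^sup>2 * (\<Sum>b\<in>Basis. T h b \<bullet> b) - p z \<bullet> T h (p z) + 2 * (p z \<bullet> P h) * (\<Sum>b\<in>Basis. A z b \<bullet> b)
      - P h \<bullet> A z (p z) - p z \<bullet> A z (P h) = H' h * W ^ 3 + 3 * H z * W * (p z \<bullet> P h)"
proof -
  have W: "W > 0" using e by (simp add: W_def add_pos_nonneg)
  have W2: "W\<^sup>2 = e\<^sup>2 + p z \<bullet> p z" by (simp add: W_def)
  \<comment> \<open>The quadratic form is expanded in the basis because the derivative of
    \<open>A x k\<close> is given only for fixed \<open>k\<close>, whereas the argument
    \<open>p x\<close> varies.\<close>
  define F where "F x = (e\<^sup>2 + p x \<bullet> p x) * (\<Sum>b\<in>Basis. A x b \<bullet> b)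
      - (\<Sum>b\<in>Basis. (p x \<bullet> b) * (p x \<bullet> A x b))" for x
  define F' where "F' h = W\<^sup>2 * (\<Sum>b\<in>Basis. T h b \<bullet> b) + 2 * (p z \<bullet> P h) * (\<Sum>b\<in>Basis. A z b \<bullet> b)
      - (\<Sum>b\<in>Basis. (p z \<bullet> b) * (p z \<bullet> T h b + P h \<bullet> A z b) + (P h \<bullet> b) * (p z \<bullet> A z b))" for h
  have dF: "(F has_derivative F') (at z)"
    unfolding F_def[abs_def]
    by (rule has_derivative_eq_rhs, (rule derivative_intros p A has_derivative_sum)+)
      (simp add: fun_eq_iff F'_def W2 inner_commute algebra_simps)
  have dR: "((\<lambda>x. H x * sqrt (e\<^sup>2 + p x \<bullet> p x) ^ 3) has_derivative
      (\<lambda>h. H' h * W ^ 3 + 3 * H z * W * (p z \<bullet> P h))) (at z)"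
    by (rule has_derivative_eq_rhs,
        rule has_derivative_mult[OF H has_derivative_power[OF has_derivative_area_element[OF p e]]])
      (unfold W_def[symmetric], use W in \<open>simp add: fun_eq_iff eval_nat_numeral\<close>)
  have expand: "L (p x) \<bullet> k = (\<Sum>b\<in>Basis. (p x \<bullet> b) * (L b \<bullet> k))" if "linear L" for L :: "'a \<Rightarrow> 'a" and x k
  proof -
    have "L (p x) \<bullet> k = (\<Sum>b\<in>Basis. (p x \<bullet> b) *\<^sub>R L b) \<bullet> k"
      by (subst linear_Basis_sum[OF that]) simp
    then show ?thesis by (simp add: inner_sum_left)
  qed
  have FR: "F x = H x * sqrt (e\<^sup>2 + p x \<bullet> p x) ^ 3" if "x \<in> S" for x
    using eq[OF that] expand[OF linA[OF that], of x "p x"] by (simp add: F_def inner_commute)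
  have "((\<lambda>x. H x * sqrt (e\<^sup>2 + p x \<bullet> p x) ^ 3) has_derivative F') (at z)"
    by (rule has_derivative_transform_within_open[OF dF S]) (use FR in simp)
  from has_derivative_unique[OF this dR]
  have F'h: "F' h = H' h * W ^ 3 + 3 * H z * W * (p z \<bullet> P h)" by metis
  have e3: "p z \<bullet> A z (P h) = (\<Sum>b\<in>Basis. (P h \<bullet> b) * (p z \<bullet> A z b))"
    by (subst linear_Basis_sum[OF linA[OF S(2)]]) (simp add: inner_sum_right)
  have "(\<Sum>b\<in>Basis. (p z \<bullet> b) * (p z \<bullet> T h b + P h \<bullet> A z b) + (P h \<bullet> b) * (p z \<bullet> A z b))
    = p z \<bullet> T h (p z) + P h \<bullet> A z (p z) + p z \<bullet> A z (P h)"
    using expand[OF linT, of z "p z"] expand[OF linA[OF S(2)], of z "P h"] e3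
    by (simp add: sum.distrib distrib_left inner_commute)
  with F'h show ?thesis by (simp add: F'_def)
qed

section \<open>Scalar inequalities for the interior maximum\<close>

text \<open>The algebraic core. In the application \<open>w\<close>, \<open>y\<close>,
  \<open>s\<close>, \<open>Y\<close> are |g|^2, g . \<sigma>X, g . p and |\<sigma>X|^2;
  \<open>a\<close> is the trace of the Hessian, \<open>t\<close> and \<open>t'\<close> carry third
  derivatives, and \<open>\<rho>\<close>, \<open>\<rho>'\<close>, \<open>\<kappa>\<close>,
  \<open>\<tau>\<close> come from the remainder R. Then \<open>lin\<close> eliminates
  \<open>t\<close> and \<open>t'\<close>, and \<open>eq\<close> eliminates \<open>a\<close>. The
  quantity \<open>d\<close> equals \<open>W\<^sup>2 - s\<close>, which is only linear in
  |g|.\<close>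

lemma bernstein_reduction:
  fixes w y Y W e s d H H' \<beta> \<eta> \<kappa> \<tau> \<rho> \<rho>' t t' a :: real
  assumes W: "W > 0" "W\<^sup>2 = e\<^sup>2 + w + 2 * y + Y" and s: "s = w + y" and d: "d = e\<^sup>2 + y + Y"
    and max: "W\<^sup>2 * (\<rho> + \<beta>\<^sup>2 * w\<^sup>2 + t + \<beta> * w * a - 2 * \<beta>\<^sup>2 * w * w)
      - (\<rho>' + \<beta>\<^sup>2 * s\<^sup>2 * w + t' + \<beta> * w * (\<kappa> - \<beta> * s\<^sup>2) - 2 * \<beta>\<^sup>2 * w * s\<^sup>2) \<le> 0"
    and lin: "W\<^sup>2 * t - t' + 2 * (\<eta> - \<beta> * w * s) * a - 2 * (\<beta>\<^sup>2 * w\<^sup>2 * s + \<tau>)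
      = H' * W ^ 3 + 3 * H * W * (\<eta> - \<beta> * w * s)"
    and eq: "W\<^sup>2 * a - (\<kappa> - \<beta> * s\<^sup>2) = H * W ^ 3"
  shows "W\<^sup>2 * \<rho> - \<rho>' + \<beta>\<^sup>2 * w * (w * (e\<^sup>2 + Y) - y\<^sup>2 - 2 * d * (e\<^sup>2 + Y) + 2 * d ^ 3 / W\<^sup>2)
    + H' * W ^ 3 + \<beta> * w * H * W * d + H * W * \<eta> + 2 * \<kappa> * (\<beta> * w * s - \<eta>) / W\<^sup>2
    + 2 * \<beta> * s\<^sup>2 * \<eta> / W\<^sup>2 + 2 * \<tau> \<le> 0" (is "?lhs \<le> 0")
proof -
  define i where "i = 1 / W\<^sup>2"
  have iV: "i * W\<^sup>2 = 1" using W(1) by (simp add: i_def)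
  have V: "W\<^sup>2 = s + d" and w: "w = s - y" and eY: "e\<^sup>2 + Y = d - y" using W s d by auto
  have "i * (W\<^sup>2 * a - (\<kappa> - \<beta> * s\<^sup>2)) = i * (H * W ^ 3)" by (simp only: eq)
  then have a: "a = H * W + (\<kappa> - \<beta> * s\<^sup>2) * i" using iV by algebra
  \<comment> \<open>Divisibility of \<open>s ^ 3 + d ^ 3\<close> by \<open>s + d\<close>, which is
    \<open>W\<^sup>2\<close>, trades \<open>s ^ 3 / W\<^sup>2\<close>, of order |g|^4, for
    \<open>d ^ 3 / W\<^sup>2\<close>, of order |g|. This exposes the cancellation of the leading
    terms.\<close>
  have cube: "(s ^ 3 + d ^ 3) * i = s\<^sup>2 - s * d + d\<^sup>2" using iV unfolding V by algebra
  have "?lhs = W\<^sup>2 * \<rho> - \<rho>' + \<beta>\<^sup>2 * w * (w * (d - y) - y\<^sup>2 - 2 * d * (d - y) + 2 * d ^ 3 * i)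
    + H' * W ^ 3 + \<beta> * w * H * W * d + H * W * \<eta> + 2 * \<kappa> * (\<beta> * w * s - \<eta>) * i
    + 2 * \<beta> * s\<^sup>2 * \<eta> * i + 2 * \<tau>" unfolding eY by (simp add: i_def)
  also have "2 * d ^ 3 * i = 2 * (s\<^sup>2 - s * d + d\<^sup>2) - 2 * s ^ 3 * i" using cube by algebra
  also have "W\<^sup>2 * \<rho> - \<rho>' + \<beta>\<^sup>2 * w * (w * (d - y) - y\<^sup>2 - 2 * d * (d - y)
        + (2 * (s\<^sup>2 - s * d + d\<^sup>2) - 2 * s ^ 3 * i))
    + H' * W ^ 3 + \<beta> * w * H * W * d + H * W * \<eta> + 2 * \<kappa> * (\<beta> * w * s - \<eta>) * i
    + 2 * \<beta> * s\<^sup>2 * \<eta> * i + 2 * \<tau>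
    = W\<^sup>2 * (\<rho> + \<beta>\<^sup>2 * w\<^sup>2 + t + \<beta> * w * a - 2 * \<beta>\<^sup>2 * w * w)
      - (\<rho>' + \<beta>\<^sup>2 * s\<^sup>2 * w + t' + \<beta> * w * (\<kappa> - \<beta> * s\<^sup>2) - 2 * \<beta>\<^sup>2 * w * s\<^sup>2)"
    using lin eq V w a by algebra
  also have "\<dots> \<le> 0" by (rule max)
  finally show ?thesis .
qed

text \<open>Bookkeeping in powers of \<open>G\<close>, the norm of the gradient. At order 4,
  \<open>\<beta>\<^sup>2 * e\<^sup>2\<close> has to beat \<open>27 * K\<close> and
  \<open>3 * \<beta> * K * D\<close>. Terms of lower order are collected in \<open>c\<close>, and
  those linear in \<open>r\<close>, the Hilbert-Schmidt norm of R, are absorbed by the good term in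
  \<open>r\<^sup>2\<close>.\<close>

lemma bernstein_positivity:
  fixes w y Y W e s d H H' \<beta> \<eta> \<kappa> \<tau> r \<rho>' G K L D c :: real
  assumes e: "e \<noteq> 0" and K: "K \<ge> 0" and L: "L \<ge> 0" and D: "D = e\<^sup>2 + L + L\<^sup>2"
    and \<beta>: "\<beta> = (1 + 27 * K + 3 * K * D) / e\<^sup>2 + 1"
    and c: "c = \<beta>\<^sup>2 * (2 * D * (e\<^sup>2 + L\<^sup>2) + 8 * D ^ 3) + 32 * \<beta> * L + 3 * K * L
      + 2 * (L\<^sup>2 * (16 * \<beta> + 8 * L) + 2 * L)\<^sup>2"
    and G: "G > c" "G \<ge> 1" "G \<ge> 3 * L" "G \<ge> \<bar>e\<bar>"
    and w: "w = G\<^sup>2" and y: "\<bar>y\<bar> \<le> L * G" and yY: "y\<^sup>2 \<le> Y * w" and Y: "0 \<le> Y" "Y \<le> L\<^sup>2"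
    and W: "W > 0" "W\<^sup>2 = e\<^sup>2 + w + 2 * y + Y" and s: "s = w + y" and d: "d = e\<^sup>2 + y + Y"
    and H: "\<bar>H\<bar> \<le> K" "\<bar>H'\<bar> \<le> K * G" and \<eta>: "\<bar>\<eta>\<bar> \<le> L * G"
    and r: "0 \<le> r" "\<rho>' \<le> r\<^sup>2 * L\<^sup>2" "\<bar>\<kappa>\<bar> \<le> L\<^sup>2 * r" "\<bar>\<tau>\<bar> \<le> G * L * r"
  shows "0 < W\<^sup>2 * r\<^sup>2 - \<rho>' + \<beta>\<^sup>2 * w * (w * (e\<^sup>2 + Y) - y\<^sup>2 - 2 * d * (e\<^sup>2 + Y) + 2 * d ^ 3 / W\<^sup>2)
    + H' * W ^ 3 + \<beta> * w * H * W * d + H * W * \<eta> + 2 * \<kappa> * (\<beta> * w * s - \<eta>) / W\<^sup>2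
    + 2 * \<beta> * s\<^sup>2 * \<eta> / W\<^sup>2 + 2 * \<tau>"
proof -
  have G0: "G > 0" using G by simp
  have D0: "D \<ge> 0" using L by (simp add: D)
  have KD: "0 \<le> 27 * K + 3 * K * D" using K D0 by simp
  then have \<beta>1: "\<beta> \<ge> 1" by (simp add: \<beta>)
  \<comment> \<open>The reason for the choice of \<open>\<beta>\<close>: it enters quadratically on
    the left but at most linearly on the right, and a margin of 1 is left over.\<close>
  have \<beta>e: "\<beta>\<^sup>2 * e\<^sup>2 \<ge> 1 + 27 * K + 3 * \<beta> * K * D"
  proof -
    have "\<beta> * e\<^sup>2 \<ge> 1 + 27 * K + 3 * K * D" using e by (simp add: \<beta> distrib_right[of _ 1 "e\<^sup>2"])
    then have "\<beta> * (\<beta> * e\<^sup>2) \<ge> \<beta> * (1 + 27 * K + 3 * K * D)" using \<beta>1 by (intro mult_left_mono) auto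
    moreover have "\<beta> * (1 + 27 * K) \<ge> 1 * (1 + 27 * K)" using \<beta>1 K by (intro mult_right_mono) auto
    ultimately show ?thesis by (simp add: power2_eq_square algebra_simps)
  qed
  have LG: "L * G \<le> G * G / 3" using G mult_right_mono[of "3 * L" G G] by simp
  have L2: "L\<^sup>2 \<le> G\<^sup>2 / 9" using G L power_mono[of "3 * L" G 2] by (simp add: power_mult_distrib)
  have e2: "e\<^sup>2 \<le> G\<^sup>2" using G power_mono[of "\<bar>e\<bar>" G 2] by simp
  have GG: "G\<^sup>2 = G * G" by (simp add: power2_eq_square)
  \<comment> \<open>Since \<open>3 * L \<le> G\<close>, the cross term \<open>2 * y\<close> is at
    most two thirds of \<open>w\<close> in absolute value, so
    \<open>G / 2 \<le> W \<le> 3 * G\<close>. The factors 4 and the powers of 3 in the bounds below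
    originate here.\<close>
  have Wlo: "G\<^sup>2 / 4 \<le> W\<^sup>2" using W w y Y LG GG by (simp add: abs_le_iff) (smt (verit) zero_le_power2)
  have "W\<^sup>2 \<le> (3 * G)\<^sup>2"
    using W w y Y LG GG L2 e2 by (simp add: abs_le_iff power_mult_distrib)
  then have Wup: "W \<le> 3 * G" by (rule power2_le_imp_le) (use G0 in simp)
  have W2: "W\<^sup>2 > 0" using W(1) by simp
  have div: "\<bar>x / W\<^sup>2\<bar> \<le> B * 4 / G\<^sup>2" if "\<bar>x\<bar> \<le> B" for x B
  proof -
    have "\<bar>x / W\<^sup>2\<bar> = \<bar>x\<bar> / W\<^sup>2" by simp
    also have "\<dots> \<le> B / (G\<^sup>2 / 4)" using that Wlo G0 W2 by (intro frac_le) auto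
    finally show ?thesis by simp
  qed
  have GL: "G \<le> G * G" using G by simp
  have dD: "\<bar>d\<bar> \<le> D * G"
  proof -
    have "\<bar>d\<bar> \<le> e\<^sup>2 + L * G + L\<^sup>2" using d y Y by (simp add: abs_le_iff) (smt (verit) zero_le_power2)
    also have "\<dots> \<le> e\<^sup>2 * G + L * G + L\<^sup>2 * G"
      using G by (intro add_mono mult_le_cancel_left1[THEN iffD2]) auto
    finally show ?thesis by (simp add: D algebra_simps)
  qed
  have s2: "\<bar>s\<bar> \<le> 2 * G\<^sup>2" using s w y LG GG by (simp add: abs_le_iff)
  \<comment> \<open>The factor 1/8 is a lower bound for 1/4 - 1/9, from \<open>Wlo\<close> and
    \<open>L2\<close>.\<close>
  have b1: "W\<^sup>2 * r\<^sup>2 - \<rho>' \<ge> r\<^sup>2 * G\<^sup>2 / 8"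
  proof -
    have "r\<^sup>2 * (G\<^sup>2 / 8) \<le> r\<^sup>2 * (W\<^sup>2 - L\<^sup>2)" using Wlo L2 zero_le_power2[of G] by (intro mult_left_mono) (linarith, simp)
    then show ?thesis using r by (simp add: algebra_simps)
  qed
  \<comment> \<open>Cauchy-Schwarz in the form \<open>y\<^sup>2 \<le> Y * w\<close> consumes the
    \<open>Y\<close> part of \<open>w * (e\<^sup>2 + Y)\<close>, leaving exactly
    \<open>w * e\<^sup>2\<close>; the rest of the bracket is only of order \<open>G\<close>.\<close>
  have b2: "\<beta>\<^sup>2 * w * (w * (e\<^sup>2 + Y) - y\<^sup>2 - 2 * d * (e\<^sup>2 + Y) + 2 * d ^ 3 / W\<^sup>2)
      \<ge> \<beta>\<^sup>2 * e\<^sup>2 * G ^ 4 - \<beta>\<^sup>2 * (2 * D * (e\<^sup>2 + L\<^sup>2) + 8 * D ^ 3) * G ^ 3"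
  proof -
    have "\<bar>d * (e\<^sup>2 + Y)\<bar> \<le> (D * G) * (e\<^sup>2 + L\<^sup>2)"
      unfolding abs_mult using dD Y by (intro mult_mono) auto
    moreover have "\<bar>d ^ 3 / W\<^sup>2\<bar> \<le> (D * G) ^ 3 * 4 / G\<^sup>2"
      by (rule div) (use dD in \<open>auto simp: power_abs intro!: power_mono\<close>)
    moreover have "(D * G) ^ 3 * 4 / G\<^sup>2 = 4 * D ^ 3 * G"
      using G0 by (simp add: eval_nat_numeral)
    ultimately have "w * (e\<^sup>2 + Y) - y\<^sup>2 - 2 * d * (e\<^sup>2 + Y) + 2 * d ^ 3 / W\<^sup>2
        \<ge> w * e\<^sup>2 - 2 * ((D * G) * (e\<^sup>2 + L\<^sup>2)) - 2 * (4 * D ^ 3 * G)"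
      using yY unfolding abs_le_iff distrib_left by (simp add: mult.commute)
    then have "\<beta>\<^sup>2 * w * (w * e\<^sup>2 - 2 * ((D * G) * (e\<^sup>2 + L\<^sup>2)) - 2 * (4 * D ^ 3 * G)) \<le>
       \<beta>\<^sup>2 * w * (w * (e\<^sup>2 + Y) - y\<^sup>2 - 2 * d * (e\<^sup>2 + Y) + 2 * d ^ 3 / W\<^sup>2)"
      by (intro mult_left_mono) (auto simp: w)
    moreover have "\<beta>\<^sup>2 * w * (w * e\<^sup>2 - 2 * ((D * G) * (e\<^sup>2 + L\<^sup>2)) - 2 * (4 * D ^ 3 * G))
       = \<beta>\<^sup>2 * e\<^sup>2 * G ^ 4 - \<beta>\<^sup>2 * (2 * D * (e\<^sup>2 + L\<^sup>2) + 8 * D ^ 3) * G ^ 3"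
      unfolding w by algebra
    ultimately show ?thesis by simp
  qed
  have b3: "\<bar>H' * W ^ 3\<bar> \<le> 27 * K * G ^ 4"
  proof -
    have "\<bar>H' * W ^ 3\<bar> \<le> (K * G) * (3 * G) ^ 3"
      unfolding abs_mult power_abs using H Wup W K G0 by (intro mult_mono power_mono) auto
    also have "\<dots> = 27 * K * G ^ 4" by algebra
    finally show ?thesis .
  qed
  have b4: "\<bar>\<beta> * w * H * W * d\<bar> \<le> 3 * \<beta> * K * D * G ^ 4"
  proof -
    have "\<bar>\<beta> * w * H * W * d\<bar> \<le> \<beta> * G\<^sup>2 * K * (3 * G) * (D * G)"
      unfolding abs_mult using H Wup W K G0 dD \<beta>1 w by (intro mult_mono) auto
    also have "\<dots> = 3 * \<beta> * K * D * G ^ 4" by algebra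
    finally show ?thesis .
  qed
  have b5: "\<bar>H * W * \<eta>\<bar> \<le> 3 * K * L * G ^ 2"
  proof -
    have "\<bar>H * W * \<eta>\<bar> \<le> K * (3 * G) * (L * G)"
      unfolding abs_mult using H Wup W K G0 \<eta> by (intro mult_mono) auto
    also have "\<dots> = 3 * K * L * G ^ 2" by algebra
    finally show ?thesis .
  qed
  have b6: "\<bar>2 * \<kappa> * (\<beta> * w * s - \<eta>) / W\<^sup>2\<bar> \<le> L\<^sup>2 * (16 * \<beta> + 8 * L) * r * G\<^sup>2"
  proof -
    have "\<bar>\<beta> * w * s\<bar> \<le> \<beta> * G\<^sup>2 * (2 * G\<^sup>2)"
      unfolding abs_mult using s2 \<beta>1 w by (intro mult_mono) auto
    moreover have "L * G \<le> L * G ^ 4"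
      using L G by (intro mult_left_mono self_le_power) auto
    ultimately have "\<bar>\<beta> * w * s - \<eta>\<bar> \<le> 2 * \<beta> * G ^ 4 + L * G ^ 4"
      using \<eta> by (simp add: abs_le_iff eval_nat_numeral mult_ac)
    then have "\<bar>2 * \<kappa> * (\<beta> * w * s - \<eta>)\<bar> \<le> 2 * (L\<^sup>2 * r) * (2 * \<beta> * G ^ 4 + L * G ^ 4)"
      unfolding abs_mult using r by (intro mult_mono) auto
    note div[OF this]
    also have "2 * (L\<^sup>2 * r) * (2 * \<beta> * G ^ 4 + L * G ^ 4) * 4 / G\<^sup>2 = L\<^sup>2 * (16 * \<beta> + 8 * L) * r * G\<^sup>2"
      using G0 by (simp add: eval_nat_numeral field_simps)
    finally show ?thesis .
  qed
  have b7: "\<bar>2 * \<beta> * s\<^sup>2 * \<eta> / W\<^sup>2\<bar> \<le> 32 * \<beta> * L * G ^ 3"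
  proof -
    have "\<bar>2 * \<beta> * s\<^sup>2 * \<eta>\<bar> \<le> 2 * \<beta> * (2 * G\<^sup>2)\<^sup>2 * (L * G)"
      unfolding abs_mult power_abs using s2 \<beta>1 \<eta> by (intro mult_mono power_mono) auto
    note div[OF this]
    also have "2 * \<beta> * (2 * G\<^sup>2)\<^sup>2 * (L * G) * 4 / G\<^sup>2 = 32 * \<beta> * L * G ^ 3"
      using G0 by (simp add: eval_nat_numeral field_simps)
    finally show ?thesis .
  qed
  have b8: "\<bar>2 * \<tau>\<bar> \<le> 2 * L * r * G\<^sup>2"
  proof -
    have "G * (L * r) \<le> G\<^sup>2 * (L * r)" using GL L r GG by (intro mult_right_mono) auto
    then show ?thesis using r by (simp add: mult_ac)
  qed
  \<comment> \<open>The coefficients of \<open>r * G\<^sup>2\<close> in \<open>b6\<close> and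
    \<open>b8\<close>. Completing the square against \<open>r\<^sup>2 * G\<^sup>2 / 8\<close> costs
    \<open>2 * c1\<^sup>2 * G\<^sup>2\<close>, which accounts for the last summand of
    \<open>c\<close>.\<close>
  define c1 where "c1 = L\<^sup>2 * (16 * \<beta> + 8 * L) + 2 * L"
  have "0 \<le> (r - 4 * c1)\<^sup>2 * G\<^sup>2 / 8" by simp
  also have "\<dots> = r\<^sup>2 * G\<^sup>2 / 8 - c1 * r * G\<^sup>2 + 2 * c1\<^sup>2 * G\<^sup>2" by algebra
  finally have r1: "r\<^sup>2 * G\<^sup>2 / 8 - c1 * r * G\<^sup>2 \<ge> - (2 * c1\<^sup>2 * G\<^sup>2)" by simp
  have c1r: "c1 * r * G\<^sup>2 = L\<^sup>2 * (16 * \<beta> + 8 * L) * r * G\<^sup>2 + 2 * L * r * G\<^sup>2"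
    unfolding c1_def by algebra
  have G23: "G\<^sup>2 \<le> G ^ 3" using G by (intro power_increasing) auto
  have g2: "(3 * K * L + 2 * c1\<^sup>2) * G\<^sup>2 \<le> (3 * K * L + 2 * c1\<^sup>2) * G ^ 3"
    using G23 K L by (intro mult_left_mono) auto
  have g4: "\<beta>\<^sup>2 * e\<^sup>2 * G ^ 4 \<ge> (1 + 27 * K + 3 * \<beta> * K * D) * G ^ 4"
    using \<beta>e by (intro mult_right_mono) auto
  \<comment> \<open>The margin in \<open>\<beta>e\<close> leaves one full \<open>G ^ 4\<close>, and
    \<open>G > c\<close> makes it exceed all cubic terms.\<close>
  have "c * G ^ 3 < G * G ^ 3" using G G0 by (intro mult_strict_right_mono) auto
  then have g5: "c * G ^ 3 < G ^ 4" by (simp add: eval_nat_numeral)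
  have g6: "c * G ^ 3 = \<beta>\<^sup>2 * (2 * D * (e\<^sup>2 + L\<^sup>2) + 8 * D ^ 3) * G ^ 3 + 32 * \<beta> * L * G ^ 3
      + (3 * K * L + 2 * c1\<^sup>2) * G ^ 3"
    unfolding c c1_def by (simp add: distrib_right)
  have g7: "(1 + 27 * K + 3 * \<beta> * K * D) * G ^ 4 = G ^ 4 + 27 * K * G ^ 4 + 3 * \<beta> * K * D * G ^ 4"
    and g8: "(3 * K * L + 2 * c1\<^sup>2) * G\<^sup>2 = 3 * K * L * G\<^sup>2 + 2 * c1\<^sup>2 * G\<^sup>2" by algebra+
  show ?thesis
    using b1 b2 b3 b4 b5 b6 b7 b8 r1 c1r g2 g4 g5 g6 g7 g8 unfolding abs_le_iff by linarith
qed

section \<open>Gradient bound at an interior maximum\<close>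

text \<open>Cauchy-Schwarz in coordinates. This norm is chosen because its square is the good term
  produced by the trace of the squared Hessian.\<close>

lemma linear_norm_le_Hilbert_Schmidt:
  fixes R :: "'a::euclidean_space \<Rightarrow> 'b::real_normed_vector"
  assumes "linear R"
  shows "norm (R y) \<le> L2_set (\<lambda>b. norm (R b)) Basis * norm y"
proof -
  have "norm (R y) \<le> (\<Sum>b\<in>Basis. \<bar>y \<bullet> b\<bar> * \<bar>norm (R b)\<bar>)"
    by (subst linear_Basis_sum[OF assms]) (rule sum_norm_le, simp)
  also have "\<dots> \<le> L2_set (\<lambda>b. y \<bullet> b) Basis * L2_set (\<lambda>b. norm (R b)) Basis"
    by (rule L2_set_mult_ineq)
  also have "L2_set (\<lambda>b. y \<bullet> b) Basis = norm y"
    by (simp add: L2_set_def norm_eq_sqrt_inner euclidean_inner[of y y] power2_eq_square)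
  finally show ?thesis by (simp add: mult.commute)
qed

text \<open>\<open>J\<close> stands for the field X. Skewness removes it from the second-order part
  of the equation and makes \<open>J g\<close> orthogonal to \<open>g\<close>; isometry bounds it by
  |g|. If the gradient exceeded the bound, \<open>bernstein_reduction\<close> and
  \<open>bernstein_positivity\<close> would give opposite signs to the same expression.\<close>

lemma interior_max_gradient_bound:
  fixes u H :: "'a::euclidean_space \<Rightarrow> real" and J :: "'a \<Rightarrow> 'a"
  assumes S: "open S" "z \<in> S" and J: "linear J" "\<And>x. J x \<bullet> x = 0" "\<And>x. norm (J x) = norm x"
    and u: "Ck_on 3 u S" and H: "H differentiable (at z)" and \<sigma>: "0 \<le> \<sigma>" "\<sigma> \<le> 1" and e: "e \<noteq> 0"
    and eq: "\<And>x. x \<in> S \<Longrightarrow> divergence (\<lambda>w. (1 / sqrt (e\<^sup>2 + (norm (grad u w + \<sigma> *\<^sub>R J w))\<^sup>2))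
                   *\<^sub>R (grad u w + \<sigma> *\<^sub>R J w)) x = \<sigma> * H x"
    and K: "\<bar>H z\<bar> \<le> K" "norm (grad H z) \<le> K" and L: "norm (J z) \<le> L"
    and D: "D = e\<^sup>2 + L + L\<^sup>2" and \<beta>: "\<beta> = (1 + 27 * K + 3 * K * D) / e\<^sup>2 + 1"
    and c: "c = \<beta>\<^sup>2 * (2 * D * (e\<^sup>2 + L\<^sup>2) + 8 * D ^ 3) + 32 * \<beta> * L + 3 * K * L
      + 2 * (L\<^sup>2 * (16 * \<beta> + 8 * L) + 2 * L)\<^sup>2"
    and max: "\<And>x. x \<in> S \<Longrightarrow>
      (grad u x \<bullet> grad u x) * exp (2 * \<beta> * u x) \<le> (grad u z \<bullet> grad u z) * exp (2 * \<beta> * u z)"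
  shows "norm (grad u z) \<le> \<bar>c\<bar> + 3 * L + \<bar>e\<bar> + 1"
proof (rule ccontr)
  assume contra: "\<not> ?thesis"
  have K0: "K \<ge> 0" using K(1) by linarith
  have L0: "L \<ge> 0" using L norm_ge_zero order_trans by blast
  obtain A T where A: "\<And>z. z \<in> S \<Longrightarrow> (grad u has_derivative A z) (at z)"
    and symA: "\<And>z h k. z \<in> S \<Longrightarrow> A z h \<bullet> k = h \<bullet> A z k"
    and T: "\<And>z k. z \<in> S \<Longrightarrow> ((\<lambda>x. A x k) has_derivative (\<lambda>h. T z h k)) (at z)"
    and linT: "\<And>z h. z \<in> S \<Longrightarrow> linear (T z h)"
    and symT: "\<And>z h k. z \<in> S \<Longrightarrow> T z h k = T z k h"
    and symT': "\<And>z h k m. z \<in> S \<Longrightarrow> T z h k \<bullet> m = T z h m \<bullet> k"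
    by (rule C3_derivatives[OF u S(1)]) (rule that)
  have linA: "linear (A x)" if "x \<in> S" for x
    using A[OF that] has_derivative_linear by blast
  have du: "(u has_derivative (\<lambda>h. grad u x \<bullet> h)) (at x)" if "x \<in> S" for x
    using u S(1) that
    by (intro has_derivative_grad) (auto simp: numeral_3_eq_3 differentiable_on_eq_differentiable_at)
  define p where "p x = grad u x + \<sigma> *\<^sub>R J x" for x
  define P where "P x h = A x h + \<sigma> *\<^sub>R J h" for x h
  have dp: "(p has_derivative P x) (at x)" if "x \<in> S" for x
    unfolding p_def[abs_def] P_def[abs_def]
    by (intro has_derivative_add has_derivative_scaleR_right A[OF that] linear_imp_has_derivative[OF J(1)])
  have eq': "(e\<^sup>2 + p x \<bullet> p x) * (\<Sum>b\<in>Basis. A x b \<bullet> b) - p x \<bullet> A x (p x)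
      = \<sigma> * H x * sqrt (e\<^sup>2 + p x \<bullet> p x) ^ 3" if "x \<in> S" for x
    using divergence_normalized_field[OF dp[OF that] e] eq[OF that]
    by (simp add: p_def[symmetric] P_def inner_add_left inner_add_right J(2) inner_commute[of _ "J _"])
  define g where "g = grad u z"
  define G where "G = norm g"
  define w where "w = g \<bullet> g"
  define Y where "Y = \<sigma> *\<^sub>R J z"
  define q where "q = \<sigma> *\<^sub>R J g"
  define y where "y = Y \<bullet> g"
  define s where "s = w + y"
  define W where "W = sqrt (e\<^sup>2 + p z \<bullet> p z)"
  define R where "R h = A z h + (\<beta> * (g \<bullet> h)) *\<^sub>R g" for h
  define r where "r = L2_set (\<lambda>b. norm (R b)) Basis"
  have G: "G > c" "G \<ge> 1" "G \<ge> 3 * L" "G \<ge> \<bar>e\<bar>"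
    using contra L0 unfolding G_def g_def by linarith+
  have wG: "w = G\<^sup>2" by (simp add: w_def G_def power2_norm_eq_inner)
  have pz: "p z = g + Y" by (simp add: p_def g_def Y_def)
  have pg: "g \<bullet> p z = s" by (simp add: pz s_def w_def y_def inner_add_right inner_commute)
  have W: "W > 0" "W\<^sup>2 = e\<^sup>2 + p z \<bullet> p z" using e by (auto simp: W_def add_pos_nonneg)
  have pp: "p z \<bullet> p z = w + 2 * y + Y \<bullet> Y"
    by (simp add: pz w_def y_def inner_add_left inner_add_right inner_commute)

  \<comment> \<open>The first derivative of |Du|^2 exp(2 \<beta> u); \<open>E h k\<close> below is
    the derivative of \<open>D1 x h\<close> at \<open>z\<close> in direction
    \<open>k\<close>.\<close>
  define D1 where "D1 x h = exp (2 * \<beta> * u x) *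
      (2 * (grad u x \<bullet> A x h) + 2 * \<beta> * (grad u x \<bullet> h) * (grad u x \<bullet> grad u x))" for x h
  have dmax: "((\<lambda>x. (grad u x \<bullet> grad u x) * exp (2 * \<beta> * u x)) has_derivative D1 x) (at x)" if "x \<in> S" for x
    by (rule has_derivative_eq_rhs, (rule derivative_intros A du that)+)
      (simp add: fun_eq_iff D1_def inner_commute algebra_simps)
  define E where "E h k = exp (2 * \<beta> * u z) * (2 * (A z k \<bullet> A z h + g \<bullet> T z k h)
      + 2 * \<beta> * ((A z k \<bullet> h) * w + (g \<bullet> h) * (2 * (g \<bullet> A z k))))
      + 2 * \<beta> * (g \<bullet> k) * D1 z h" for h k
  have dD1: "((\<lambda>x. D1 x h) has_derivative E h) (at z)" for h
    unfolding D1_def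
    by (rule has_derivative_eq_rhs, (rule derivative_intros A T du S(2))+)
      (simp add: fun_eq_iff E_def D1_def g_def w_def inner_commute algebra_simps)
  note test = second_derivative_test_max[OF S max dmax dD1]
  have crit: "g \<bullet> A z h = - \<beta> * w * (g \<bullet> h)" for h
  proof -
    have "2 * (g \<bullet> A z h) + 2 * \<beta> * (g \<bullet> h) * w = 0"
      using test(1)[of h] by (simp add: D1_def g_def w_def)
    then show ?thesis by (simp add: algebra_simps)
  qed
  have Ag: "A z g = (- \<beta> * w) *\<^sub>R g"
  proof (rule vector_eq_ldot[THEN iffD1], intro allI)
    show "h \<bullet> A z g = h \<bullet> ((- \<beta> * w) *\<^sub>R g)" for h
      using crit[of h] symA[OF S(2), of h g] by (simp add: inner_commute)
  qed
  \<comment> \<open>The diagonal values \<open>B h h\<close> are the second derivatives of the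
    auxiliary function at \<open>z\<close>, simplified by the first-order condition and divided by
    \<open>2 * exp (2 * \<beta> * u z)\<close>.\<close>
  define B where "B h k = A z h \<bullet> A z k + g \<bullet> T z h k + \<beta> * w * (A z h \<bullet> k)
      - 2 * \<beta>\<^sup>2 * w * ((g \<bullet> h) * (g \<bullet> k))" for h k
  have Bneg: "B h h \<le> 0" for h
  proof -
    have "E h h = 2 * exp (2 * \<beta> * u z) * B h h"
      using test(1)[of h] by (simp add: E_def B_def crit power2_eq_square algebra_simps)
    moreover have "E h h \<le> 0" by (rule test(2))
    ultimately show ?thesis by (simp add: mult_le_0_iff)
  qed
  have linA': "A z (x + y) = A z x + A z y" "A z (a *\<^sub>R x) = a *\<^sub>R A z x" for x y a
    using linA[OF S(2)] by (auto simp: linear_add linear_scale)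
  have linT1: "T z h (x + y) = T z h x + T z h y" "T z h (a *\<^sub>R x) = a *\<^sub>R T z h x" for h x y a
    using linT[OF S(2), of h] by (auto simp: linear_add linear_scale)
  have linT2: "T z (x + y) h = T z x h + T z y h" "T z (a *\<^sub>R x) h = a *\<^sub>R T z x h" for h x y a
    by (simp_all add: symT[OF S(2), of _ h] linT1)
  have "bilinear B"
    unfolding bilinear_def B_def
    by (auto intro!: linearI simp: linA' linT1 linT2 inner_add_left inner_add_right algebra_simps)
  from trace_form_nonpos[OF this Bneg, of "e\<^sup>2" "p z"]
  have max': "W\<^sup>2 * (\<Sum>b\<in>Basis. B b b) - B (p z) (p z) \<le> 0" by (simp add: W(2))

  have linR: "linear R"
    by (auto intro!: linearI simp: R_def linA' inner_add_right algebra_simps)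
  have symR: "R h \<bullet> k = h \<bullet> R k" for h k
    using symA[OF S(2), of h k] by (simp add: R_def inner_add_left inner_add_right inner_commute[of h g])
  have Rg: "R g = 0" by (simp add: R_def Ag w_def flip: scaleR_add_left)
  have Rg': "R h \<bullet> g = 0" "g \<bullet> R h = 0" for h using symR[of h g] Rg by (simp_all add: inner_commute)
  have AR: "A z h = R h - (\<beta> * (g \<bullet> h)) *\<^sub>R g" for h by (simp add: R_def)
  have Ap: "A z (p z) = R Y - (\<beta> * s) *\<^sub>R g"
    using Rg linear_add[OF linR, of g Y] by (simp add: AR pg) (simp add: pz)
  have sumgg: "(\<Sum>b\<in>Basis. (g \<bullet> b) * (g \<bullet> b)) = w"
    by (simp add: w_def euclidean_inner[of g g])
  have r2: "r\<^sup>2 = (\<Sum>b\<in>Basis. R b \<bullet> R b)"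
    by (simp add: r_def L2_set_def sum_nonneg power2_norm_eq_inner)
  have trB: "(\<Sum>b\<in>Basis. B b b) = r\<^sup>2 + \<beta>\<^sup>2 * w\<^sup>2 + (\<Sum>b\<in>Basis. T z g b \<bullet> b)
      + \<beta> * w * (\<Sum>b\<in>Basis. A z b \<bullet> b) - 2 * \<beta>\<^sup>2 * w * w"
  proof -
    have "A z b \<bullet> A z b = R b \<bullet> R b + \<beta>\<^sup>2 * w * ((g \<bullet> b) * (g \<bullet> b))" for b
      by (simp add: AR inner_diff_left inner_diff_right Rg' w_def power2_eq_square)
    \<comment> \<open>Total symmetry moves \<open>g\<close> into the differentiation slot, so that
      the trace becomes the one in the equation differentiated along \<open>g\<close>.\<close>
    moreover have "g \<bullet> T z b b = T z g b \<bullet> b" for b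
      using symT'[OF S(2), of b b g] symT[OF S(2), of b g] by (simp add: inner_commute)
    ultimately have "B b b = R b \<bullet> R b + \<beta>\<^sup>2 * w * ((g \<bullet> b) * (g \<bullet> b)) + T z g b \<bullet> b
        + \<beta> * w * (A z b \<bullet> b) - 2 * \<beta>\<^sup>2 * w * ((g \<bullet> b) * (g \<bullet> b))" for b
      by (simp add: B_def)
    then show ?thesis unfolding r2
      by (simp add: sum.distrib sum_subtractf sum_distrib_left[symmetric] sumgg power2_eq_square)
  qed
  have pAp: "p z \<bullet> A z (p z) = Y \<bullet> R Y - \<beta> * s\<^sup>2"
  proof -
    have "p z \<bullet> A z (p z) = p z \<bullet> R Y - \<beta> * s * (g \<bullet> p z)"
      by (simp add: Ap inner_diff_right inner_commute[of g])
    then show ?thesis by (simp add: pg) (simp add: pz inner_add_left Rg' power2_eq_square)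
  qed
  have Bpp: "B (p z) (p z) = R Y \<bullet> R Y + \<beta>\<^sup>2 * s\<^sup>2 * w + p z \<bullet> T z g (p z)
      + \<beta> * w * (Y \<bullet> R Y - \<beta> * s\<^sup>2) - 2 * \<beta>\<^sup>2 * w * s\<^sup>2"
  proof -
    have "A z (p z) \<bullet> A z (p z) = R Y \<bullet> R Y + \<beta>\<^sup>2 * s\<^sup>2 * w"
      by (simp add: Ap inner_diff_left inner_diff_right Rg' w_def power2_eq_square)
    moreover have "g \<bullet> T z (p z) (p z) = p z \<bullet> T z g (p z)"
      using symT'[OF S(2), of "p z" "p z" g] symT[OF S(2), of "p z" g] by (simp add: inner_commute)
    ultimately show ?thesis
      by (simp add: B_def pg pAp[unfolded inner_commute[of "p z"]] power2_eq_square)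
  qed
  have qg: "g \<bullet> q = 0" "q \<bullet> g = 0" using J(2)[of g] by (simp_all add: q_def inner_commute)
  have Pg: "P z g = (- \<beta> * w) *\<^sub>R g + q" by (simp add: P_def Ag q_def)
  have pPg: "p z \<bullet> P z g = Y \<bullet> q - \<beta> * w * s"
    by (simp add: Pg pz inner_add_left inner_diff_right qg s_def y_def distrib_left w_def[symmetric])
  have PgAp: "P z g \<bullet> A z (p z) = \<beta>\<^sup>2 * w\<^sup>2 * s + q \<bullet> R Y"
    by (simp add: Pg Ap inner_diff_left inner_diff_right Rg' qg w_def[symmetric] power2_eq_square)
  have dH: "((\<lambda>x. \<sigma> * H x) has_derivative (\<lambda>h. \<sigma> * (grad H z \<bullet> h))) (at z)"
    by (intro has_derivative_mult_right has_derivative_grad H)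
  \<comment> \<open>The direction \<open>g\<close> matches the third-order terms in
    \<open>trB\<close> and \<open>Bpp\<close>; symmetry of the Hessian merges the two cross terms
    into the factor 2.\<close>
  have lin: "W\<^sup>2 * (\<Sum>b\<in>Basis. T z g b \<bullet> b) - p z \<bullet> T z g (p z)
      + 2 * (Y \<bullet> q - \<beta> * w * s) * (\<Sum>b\<in>Basis. A z b \<bullet> b) - 2 * (\<beta>\<^sup>2 * w\<^sup>2 * s + q \<bullet> R Y)
    = \<sigma> * (grad H z \<bullet> g) * W ^ 3 + 3 * (\<sigma> * H z) * W * (Y \<bullet> q - \<beta> * w * s)"
    using linearized_equation[OF S e dp[OF S(2)] T[OF S(2)] linA linT[OF S(2)] dH eq', of g]
      symA[OF S(2), of "p z" "P z g"]
    by (simp add: W_def[symmetric] pPg PgAp[unfolded inner_commute[of "P z g"]] PgAp inner_commute[of "A z (p z)"])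
  have eqz: "W\<^sup>2 * (\<Sum>b\<in>Basis. A z b \<bullet> b) - (Y \<bullet> R Y - \<beta> * s\<^sup>2) = \<sigma> * H z * W ^ 3"
    using eq'[OF S(2)] by (simp add: pAp W_def[symmetric] W(2))
  \<comment> \<open>Here \<open>\<rho>\<close> is \<open>r\<^sup>2\<close>, \<open>\<rho>'\<close>
    is \<open>R Y \<bullet> R Y\<close>, \<open>\<eta>\<close> is \<open>Y \<bullet> q\<close>,
    \<open>\<kappa>\<close> is \<open>Y \<bullet> R Y\<close> and \<open>\<tau>\<close> is
    \<open>q \<bullet> R Y\<close>.\<close>
  note ineq = bernstein_reduction[OF W(1) W(2)[unfolded pp, folded add.assoc] s_def refl
      max'[unfolded trB Bpp] lin eqz]

  \<comment> \<open>From here on \<open>\<sigma>\<close> is used only through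
    \<open>0 \<le> \<sigma> \<le> 1\<close>, which makes the bounds uniform in it.\<close>
  have nY: "norm Y \<le> L"
    using \<sigma> L mult_mono[of \<sigma> 1 "norm (J z)" L] by (simp add: Y_def)
  have nq: "norm q \<le> G"
    using \<sigma> mult_right_mono[of \<sigma> 1 G] by (simp add: q_def J(3) G_def)
  have r0: "r \<ge> 0" by (simp add: r_def L2_set_nonneg)
  have nRY: "norm (R Y) \<le> r * L"
    using linear_norm_le_Hilbert_Schmidt[OF linR, of Y] mult_left_mono[OF nY r0] by (simp add: r_def)
  have cs: "\<bar>a \<bullet> b\<bar> \<le> M * N" if "norm a \<le> M" "norm b \<le> N" for a b :: 'a and M N
    using Cauchy_Schwarz_ineq2[of a b] mult_mono[OF that] that norm_ge_zero[of a] norm_ge_zero[of b]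
    by linarith
  have "0 < W\<^sup>2 * r\<^sup>2 - R Y \<bullet> R Y + \<beta>\<^sup>2 * w * (w * (e\<^sup>2 + Y \<bullet> Y) - y\<^sup>2
      - 2 * (e\<^sup>2 + y + Y \<bullet> Y) * (e\<^sup>2 + Y \<bullet> Y) + 2 * (e\<^sup>2 + y + Y \<bullet> Y) ^ 3 / W\<^sup>2)
    + \<sigma> * (grad H z \<bullet> g) * W ^ 3 + \<beta> * w * (\<sigma> * H z) * W * (e\<^sup>2 + y + Y \<bullet> Y)
    + \<sigma> * H z * W * (Y \<bullet> q) + 2 * (Y \<bullet> R Y) * (\<beta> * w * s - Y \<bullet> q) / W\<^sup>2
    + 2 * \<beta> * s\<^sup>2 * (Y \<bullet> q) / W\<^sup>2 + 2 * (q \<bullet> R Y)"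
  proof (rule bernstein_positivity[OF e K0 L0 D \<beta> c G wG])
    show "\<bar>y\<bar> \<le> L * G" unfolding y_def G_def by (intro cs nY) simp
    show "y\<^sup>2 \<le> Y \<bullet> Y * w" unfolding y_def w_def by (rule Cauchy_Schwarz_ineq)
    show "Y \<bullet> Y \<le> L\<^sup>2" using cs[OF nY nY] by (simp add: power2_eq_square)
    show "W\<^sup>2 = e\<^sup>2 + w + 2 * y + Y \<bullet> Y" using W(2) pp by simp
    show "\<bar>\<sigma> * H z\<bar> \<le> K"
      using \<sigma> K mult_mono[of \<sigma> 1 "\<bar>H z\<bar>" K] by (simp add: abs_mult)
    have "\<bar>grad H z \<bullet> g\<bar> \<le> K * G" unfolding G_def by (intro cs K) simp
    then show "\<bar>\<sigma> * (grad H z \<bullet> g)\<bar> \<le> K * G"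
      using \<sigma> mult_mono[of \<sigma> 1 "\<bar>grad H z \<bullet> g\<bar>" "K * G"] by (simp add: abs_mult)
    show "\<bar>Y \<bullet> q\<bar> \<le> L * G" by (intro cs nY nq)
    show "R Y \<bullet> R Y \<le> r\<^sup>2 * L\<^sup>2" using cs[OF nRY nRY] by (simp add: power2_eq_square mult_ac)
    show "\<bar>Y \<bullet> R Y\<bar> \<le> L\<^sup>2 * r" using cs[OF nY nRY] by (simp add: power2_eq_square mult_ac)
    show "\<bar>q \<bullet> R Y\<bar> \<le> G * L * r" using cs[OF nq nRY] by (simp add: mult_ac)
  qed (auto simp: W s_def r0)
  with ineq show False by linarith
qed

section \<open>From the maximum point to the whole domain\<close>

text \<open>A real \<open>SUP\<close> bounds its members only when they are bounded above;
  compactness provides this.\<close>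

lemma compact_norm_le_SUP:
  fixes f :: "'a::topological_space \<Rightarrow> 'b::real_normed_vector"
  assumes "compact S" "continuous_on S f" "x \<in> S"
  shows "norm (f x) \<le> (SUP x\<in>S. norm (f x))"
proof (rule cSUP_upper[OF assms(3)])
  have "compact ((\<lambda>x. norm (f x)) ` S)"
    using assms by (intro compact_continuous_image continuous_intros) auto
  then show "bdd_above ((\<lambda>x. norm (f x)) ` S)"
    by (intro bounded_imp_bdd_above compact_imp_bounded)
qed

lemma linear_Xfield: "linear Xfield"
  by (rule linearI) (simp_all add: Xfield_def prod_eq_iff)

lemma Xfield_skew: "Xfield z \<bullet> z = 0"
  by (simp add: Xfield_def inner_prod_def inner_commute)

lemma norm_Xfield: "norm (Xfield z) = norm z"
  by (simp add: Xfield_def norm_prod_def add.commute)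

theorem theorem4p2:
  fixes \<epsilon> M K L :: real
  assumes "\<epsilon> \<noteq> 0"
  shows "\<exists>C>0. \<forall>(\<Omega> :: ((real^'n) \<times> (real^'n)) set) (H :: (real^'n) \<times> (real^'n) \<Rightarrow> real) GH
                  (\<sigma>::real) (u :: (real^'n) \<times> (real^'n) \<Rightarrow> real) G.
      open \<Omega> \<and> connected \<Omega> \<and> \<Omega> \<noteq> {} \<and> bounded \<Omega>
      \<and> C1_closure_ext H GH \<Omega>
      \<and> 0 \<le> \<sigma> \<and> \<sigma> \<le> 1
      \<and> Ck_on 3 u \<Omega> \<and> C1_closure_ext u G \<Omega>
      \<and> (\<forall>z\<in>\<Omega>. divergence (\<lambda>w. (1 / sqrt (\<epsilon>\<^sup>2 + (norm (grad u w + \<sigma> *\<^sub>R Xfield w))\<^sup>2))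
                   *\<^sub>R (grad u w + \<sigma> *\<^sub>R Xfield w)) z = \<sigma> * H z)
      \<and> (SUP z\<in>\<Omega>. \<bar>u z\<bar>) \<le> M
      \<and> (SUP z\<in>closure \<Omega>. \<bar>H z\<bar>) + (SUP z\<in>closure \<Omega>. norm (GH z)) \<le> K
      \<and> (SUP z\<in>\<Omega>. norm (Xfield z)) \<le> L
      \<longrightarrow> (SUP z\<in>\<Omega>. norm (grad u z)) \<le> C * ((SUP z\<in>frontier \<Omega>. norm (G z)) + 1)"
proof -
  define D where "D = \<epsilon>\<^sup>2 + L + L\<^sup>2"
  define \<beta> where "\<beta> = (1 + 27 * K + 3 * K * D) / \<epsilon>\<^sup>2 + 1"
  define c where "c = \<beta>\<^sup>2 * (2 * D * (\<epsilon>\<^sup>2 + L\<^sup>2) + 8 * D ^ 3) + 32 * \<beta> * L + 3 * K * L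
      + 2 * (L\<^sup>2 * (16 * \<beta> + 8 * L) + 2 * L)\<^sup>2"
  \<comment> \<open>\<open>K\<close> and \<open>L\<close> are still arbitrary reals, fixed before
    any domain, so the signs of \<open>L\<close>, \<open>c\<close> and \<open>\<beta>\<close> are
    unknown; hence the absolute values here and in \<open>Q\<close>.\<close>
  define \<Lambda> where "\<Lambda> = \<bar>c\<bar> + 3 * \<bar>L\<bar> + \<bar>\<epsilon>\<bar> + 1"
  \<comment> \<open>On the closure \<open>u\<close> varies by at most \<open>2 * M\<close>, so the
    exponential weights at two points differ by a factor of at most \<open>Q\<^sup>2\<close>. The
    weight multiplies the squared gradient, so the gradient itself loses a factor
    \<open>Q\<close>.\<close>
  define Q where "Q = exp (2 * \<bar>\<beta>\<bar> * M)"
  have \<Lambda>: "\<Lambda> \<ge> 1" by (simp add: \<Lambda>_def)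
  have Q: "Q > 0" by (simp add: Q_def)
  show ?thesis
  proof (intro exI[of _ "Q * \<Lambda>"] conjI allI impI)
    show "0 < Q * \<Lambda>" using \<Lambda> Q by simp
    fix \<Omega> :: "((real^'n) \<times> (real^'n)) set" and H u :: "(real^'n) \<times> (real^'n) \<Rightarrow> real"
      and GH G :: "(real^'n) \<times> (real^'n) \<Rightarrow> (real^'n) \<times> (real^'n)" and \<sigma> :: real
    assume asm: "open \<Omega> \<and> connected \<Omega> \<and> \<Omega> \<noteq> {} \<and> bounded \<Omega>
      \<and> C1_closure_ext H GH \<Omega>
      \<and> 0 \<le> \<sigma> \<and> \<sigma> \<le> 1
      \<and> Ck_on 3 u \<Omega> \<and> C1_closure_ext u G \<Omega>
      \<and> (\<forall>z\<in>\<Omega>. divergence (\<lambda>w. (1 / sqrt (\<epsilon>\<^sup>2 + (norm (grad u w + \<sigma> *\<^sub>R Xfield w))\<^sup>2))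
                   *\<^sub>R (grad u w + \<sigma> *\<^sub>R Xfield w)) z = \<sigma> * H z)
      \<and> (SUP z\<in>\<Omega>. \<bar>u z\<bar>) \<le> M
      \<and> (SUP z\<in>closure \<Omega>. \<bar>H z\<bar>) + (SUP z\<in>closure \<Omega>. norm (GH z)) \<le> K
      \<and> (SUP z\<in>\<Omega>. norm (Xfield z)) \<le> L"
    let ?B = "SUP z\<in>frontier \<Omega>. norm (G z)"
    have op: "open \<Omega>" and ne: "\<Omega> \<noteq> {}" and bd: "bounded \<Omega>" and \<sigma>: "0 \<le> \<sigma>" "\<sigma> \<le> 1"
      and C3: "Ck_on 3 u \<Omega>" using asm by auto
    have cu: "continuous_on (closure \<Omega>) u" and cG: "continuous_on (closure \<Omega>) G"
      and Gg: "\<And>z. z \<in> \<Omega> \<Longrightarrow> G z = grad u z"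
      and cH: "continuous_on (closure \<Omega>) H" and cGH: "continuous_on (closure \<Omega>) GH"
      and GHg: "\<And>z. z \<in> \<Omega> \<Longrightarrow> GH z = grad H z" and H1: "Ck_on 1 H \<Omega>"
      using asm by (auto simp: C1_closure_ext_def)
    have cpt: "compact (closure \<Omega>)" using bd by simp
    have sub: "\<Omega> \<subseteq> closure \<Omega>" by (rule closure_subset)
    have bdd: "bdd_above ((\<lambda>z. norm (f z)) ` \<Omega>)" if "continuous_on (closure \<Omega>) f"
      for f :: "(real^'n) \<times> (real^'n) \<Rightarrow> 'b::real_normed_vector"
      using compact_norm_le_SUP[OF cpt that] sub by (intro bdd_aboveI2) blast
    \<comment> \<open>The bound is extended by continuity because the maximum point may lie on the
      boundary.\<close>
    have uM: "\<bar>u z\<bar> \<le> M" if "z \<in> closure \<Omega>" for z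
    proof -
      have "norm (u x) \<le> M" if "x \<in> \<Omega>" for x
        using cSUP_upper[OF that bdd[OF cu]] asm by simp
      then show ?thesis using continuous_on_closure_norm_le[OF cu] that by fastforce
    qed
    have HK: "\<bar>H z\<bar> \<le> K" "norm (grad H z) \<le> K" if "z \<in> \<Omega>" for z
    proof -
      have z: "z \<in> closure \<Omega>" using that sub by blast
      have "\<bar>H z\<bar> + norm (GH z) \<le> K"
        using compact_norm_le_SUP[OF cpt cH z] compact_norm_le_SUP[OF cpt cGH z] asm by simp
      then show "\<bar>H z\<bar> \<le> K" "norm (grad H z) \<le> K"
        unfolding GHg[OF that, symmetric] using norm_ge_zero[of "GH z"] by linarith+
    qed
    have XL: "norm (Xfield z) \<le> L" if "z \<in> \<Omega>" for z
      using cSUP_upper[OF that bdd[OF linear_continuous_on[OF linear_linear[THEN iffD2, OF linear_Xfield]]]]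
        asm by simp
    have B: "norm (G z) \<le> ?B" if "z \<in> frontier \<Omega>" for z
      using compact_norm_le_SUP[OF compact_frontier_bounded[OF bd] continuous_on_subset[OF cG] that]
      by (simp add: frontier_def)
    \<comment> \<open>A bounded nonempty open set has a boundary, so the supremum over it is a
      genuine one and is nonnegative.\<close>
    have "frontier \<Omega> \<noteq> {}" using op ne bd by (simp add: frontier_eq_empty) (metis not_bounded_UNIV)
    then have B0: "?B \<ge> 0" using B norm_ge_zero order_trans by (metis ex_in_conv)
    \<comment> \<open>The auxiliary function is formed with the continuous extension
      \<open>G\<close> of the gradient, so that it attains its maximum on the compact
      closure.\<close>
    define \<Phi> where "\<Phi> z = (G z \<bullet> G z) * exp (2 * \<beta> * u z)" for z
    have "continuous_on (closure \<Omega>) \<Phi>"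
      unfolding \<Phi>_def by (intro continuous_intros cu cG)
    then obtain z0 where z0: "z0 \<in> closure \<Omega>" "\<And>z. z \<in> closure \<Omega> \<Longrightarrow> \<Phi> z \<le> \<Phi> z0"
      using continuous_attains_sup[OF cpt] ne by (metis closure_eq_empty)
    have G0: "norm (G z0) \<le> \<Lambda> * (?B + 1)"
    proof (cases "z0 \<in> \<Omega>")
      case True
      have "norm (grad u z0) \<le> \<bar>c\<bar> + 3 * L + \<bar>\<epsilon>\<bar> + 1"
      proof (rule interior_max_gradient_bound[OF op True linear_Xfield Xfield_skew norm_Xfield C3 _ \<sigma> assms _
            HK[OF True] XL[OF True] D_def \<beta>_def c_def])
        show "H differentiable (at z0)"
          using H1 op True by (simp add: differentiable_on_eq_differentiable_at)
        show "(grad u x \<bullet> grad u x) * exp (2 * \<beta> * u x) \<le> (grad u z0 \<bullet> grad u z0) * exp (2 * \<beta> * u z0)"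
          if "x \<in> \<Omega>" for x
          using z0(2)[of x] that sub Gg[OF that] Gg[OF True] by (auto simp: \<Phi>_def)
      qed (use asm in blast)
      also have "\<dots> \<le> \<Lambda>" by (simp add: \<Lambda>_def)
      also have "\<dots> \<le> \<Lambda> * (?B + 1)" using \<Lambda> B0 by (simp add: mult_le_cancel_left1)
      finally show ?thesis by (simp add: Gg[OF True])
    next
      case False
      then have "norm (G z0) \<le> ?B + 1"
        using z0 op B[of z0] by (simp add: frontier_def interior_open)
      also have "\<dots> \<le> \<Lambda> * (?B + 1)" using \<Lambda> B0 by (simp add: mult_le_cancel_right1)
      finally show ?thesis .
    qed
    show "(SUP z\<in>\<Omega>. norm (grad u z)) \<le> Q * \<Lambda> * (?B + 1)"
    proof (rule cSUP_least[OF ne])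
      \<comment> \<open>Comparing \<open>\<Phi> z\<close> with \<open>\<Phi> z0\<close> transfers
        the bound at \<open>z0\<close> to every point, at the price of the ratio of the exponential
        weights.\<close>
      fix z assume z: "z \<in> \<Omega>"
      have zc: "z \<in> closure \<Omega>" using z sub by blast
      have "2 * \<beta> * (u z0 - u z) \<le> 2 * \<bar>\<beta>\<bar> * (2 * M)"
      proof -
        have "\<beta> * (u z0 - u z) \<le> \<bar>\<beta>\<bar> * \<bar>u z0 - u z\<bar>" by (metis abs_ge_self abs_mult)
        also have "\<dots> \<le> \<bar>\<beta>\<bar> * (2 * M)" using uM[OF zc] uM[OF z0(1)] by (intro mult_left_mono) auto
        finally show ?thesis by linarith
      qed
      then have "exp (2 * \<beta> * (u z0 - u z)) \<le> exp (2 * \<bar>\<beta>\<bar> * (2 * M))" by simp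
      also have "\<dots> = Q\<^sup>2" by (simp add: Q_def power2_eq_square flip: exp_add)
      finally have ex: "exp (2 * \<beta> * (u z0 - u z)) \<le> Q\<^sup>2" .
      have "(G z \<bullet> G z) * exp (2 * \<beta> * u z) \<le> (G z0 \<bullet> G z0) * exp (2 * \<beta> * u z0)"
        using z0(2)[OF zc] by (simp add: \<Phi>_def)
      then have "G z \<bullet> G z \<le> (G z0 \<bullet> G z0) * exp (2 * \<beta> * (u z0 - u z))"
        by (simp add: right_diff_distrib exp_diff pos_le_divide_eq)
      also have "\<dots> \<le> (G z0 \<bullet> G z0) * Q\<^sup>2" using ex by (intro mult_left_mono) auto
      finally have "(norm (G z))\<^sup>2 \<le> (Q * norm (G z0))\<^sup>2"
        by (simp add: power2_norm_eq_inner power_mult_distrib mult.commute)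
      then have "norm (G z) \<le> Q * norm (G z0)" by (rule power2_le_imp_le) (use Q in simp)
      also have "\<dots> \<le> Q * (\<Lambda> * (?B + 1))" using G0 Q by (intro mult_left_mono) auto
      finally show "norm (grad u z) \<le> Q * \<Lambda> * (?B + 1)" using Gg[OF z] by (simp add: mult.assoc)
    qed
  qed
qed

end
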